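(* Let $r\ge 1$ and let $\mathbf{k}=(k_1,\ldots,k_r)\in\mathbb{Z}_{\geq1}^r$. Then there exist complex numbers $\widetilde{C}_{\mathbf{k}}(\mathbf{k}';j)$, indexed by indices $\mathbf{k}'$ (possibly empty) and integers $j\ge 0$ with $\mathrm{wt}(\mathbf{k}')+j\le \mathrm{wt}(\mathbf{k})$, such that each $\widetilde{C}_{\mathbf{k}}(\mathbf{k}';j)$ is a $\mathbb{Q}$-linear combination of multiple $\widetilde{T}$-values of weight $\mathrm{wt}(\mathbf{k})-\mathrm{wt}(\mathbf{k}')-j$, and such that for all $s\in\mathbb{C}$ with $\mathrm{Re}(s)>1$, \[ \lambda(\mathbf{k};s)=i^{\mathrm{wt}(\mathbf{k})-\mathrm{dep}(\mathbf{k})}\sum_{\mathbf{k}',\,j\geq0} \widetilde{C}_{\mathbf{k}}(\mathbf{k}';j)\binom{s+j-1}{j}\widetilde{T}(\mathbf{k}',s+j), \] the sum running over all indices $\mathbf{k}'$ and $j\in\mathbb{Z}_{\ge0}$ with $\mathrm{wt}(\mathbf{k}')+j\le\mathrm{wt}(\mathbf{k})$.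
   Context: An index is a tuple $\mathbf{k}=(k_1,\ldots,k_r)$ of positive integers; $\mathrm{wt}(\mathbf{k})=k_1+\cdots+k_r$, $\mathrm{dep}(\mathbf{k})=r$. The empty index $\phi$ has weight and depth $0$; the constant $1$ is regarded as the (unique) multiple $\widetilde{T}$-value of weight $0$. An index is admissible if $k_r\ge2$. For an index $(k_1,\ldots,k_r)$ (entries positive integers, or the last entry a complex number $s$ with $\mathrm{Re}(s)$ large enough for convergence), \[ \widetilde{T}(k_1,\ldots,k_r)=2^r\sum_{\substack{0<m_1<\cdots<m_r\\ m_j\equiv j \bmod 2}}\frac{(-1)^{(m_r-r)/2}}{m_1^{k_1}\cdots m_r^{k_r}}, \] and $\widetilde{T}(\phi)=1$; a multiple $\widetilde{T}$-value of weight $w$ is a value $\widetilde{T}(\mathbf{l})$ for an index $\mathbf{l}$ of positive integers of weight $w$ for which the series converges. The multiple polylogarithm of level four $\mathscr{A}(\mathbf{k};z)$ is defined recursively by $\mathscr{A}(\phi;z)=1$ and \[ \mathscr{A}(k_1,\ldots,k_r;z)=\begin{cases}\int_i^z \frac{1}{u}\mathscr{A}(k_1,\ldots,k_{r-1},k_r-1;u)\,du & (k_r\ge2),\\ \int_i^z\frac{2}{1-u^2}\mathscr{A}(k_1,\ldots,k_{r-1};u)\,du & (k_r=1).\end{cases} \] Kaneko–Tsumura's $\lambda$ function is \[ \lambda(\mathbf{k};s)=\frac{1}{\Gamma(s)}\int_0^\infty t^{s-1}\frac{\mathscr{A}\bigl(\mathbf{k};\tanh(t/2+\pi i/4)\bigr)}{\cosh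 t}\,dt . \] For complex $s$ and $j\ge0$, $\binom{s+j-1}{j}=s(s+1)\cdots(s+j-1)/j!$. *)

theory Defs
  imports "HOL-Complex_Analysis.Complex_Analysis"
begin

definition is_index :: "nat list \<Rightarrow> bool" where
  "is_index ks \<longleftrightarrow> (\<forall>k\<in>set ks. 1 \<le> k)"

definition wt :: "nat list \<Rightarrow> nat" where
  "wt ks = sum_list ks"

definition dep :: "nat list \<Rightarrow> nat" where
  "dep ks = length ks"


text \<open>The summation sequences \<open>0 < m\<^sub>1 < \<dots> < m\<^sub>r = m\<close> with \<open>m\<^sub>j \<equiv> j\<close> modulo 2.
  List positions start at 0, so \<open>m\<^sub>j\<close> is \<open>ms ! (j - 1)\<close>.\<close>

definition Ttilde_seqs :: "nat \<Rightarrow> nat \<Rightarrow> nat list set" where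
  "Ttilde_seqs r m = {ms. length ms = r \<and> sorted_wrt (<) ms \<and>
     (\<forall>j<r. 0 < ms ! j \<and> ms ! j mod 2 = Suc j mod 2) \<and> last ms = m}"

definition Ttilde_term :: "complex list \<Rightarrow> nat \<Rightarrow> complex" where
  "Ttilde_term ks m = (\<Sum>ms\<in>Ttilde_seqs (length ks) m.
     (-1) ^ ((m - length ks) div 2) / (\<Prod>j<length ks. of_nat (ms ! j) powr (ks ! j)))"

text \<open>The series converges only conditionally when the last entry is 1 (for example
  \<open>Ttilde [1] = pi / 2\<close>). It is read as the limit of its partial sums over the outermost
  variable \<open>m\<^sub>r\<close>; for fixed \<open>m\<^sub>r\<close> the sum over the other variables is finite.\<close>

definition Ttilde_converges :: "complex list \<Rightarrow> bool" where
  "Ttilde_converges ks \<longleftrightarrow> ks = [] \<or> summable (Ttilde_term ks)"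

definition Ttilde :: "complex list \<Rightarrow> complex" where
  "Ttilde ks = (if ks = [] then 1 else 2 ^ length ks * (\<Sum>m. Ttilde_term ks m))"

definition multiple_Ttilde_values :: "nat \<Rightarrow> complex set" where
  "multiple_Ttilde_values w =
     {Ttilde (map of_nat ls) | ls. is_index ls \<and> wt ls = w \<and> Ttilde_converges (map of_nat ls)}"

lemma finite_Ttilde_seqs: "finite (Ttilde_seqs r m)"
proof (rule finite_subset)
  show "Ttilde_seqs r m \<subseteq> {ms. set ms \<subseteq> {..m} \<and> length ms = r}"
  proof
    fix ms assume "ms \<in> Ttilde_seqs r m"
    then have ms: "length ms = r" "sorted_wrt (<) ms" "last ms = m"
      by (auto simp: Ttilde_seqs_def)
    have "x \<le> m" if "x \<in> set ms" for x
    proof (cases ms rule: rev_cases)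
      case (snoc ys y)
      then show ?thesis using ms that by (auto simp: sorted_wrt_append intro: less_imp_le)
    qed (use that in auto)
    then show "ms \<in> {ms. set ms \<subseteq> {..m} \<and> length ms = r}" using ms by auto
  qed
  show "finite {ms. set ms \<subseteq> {..m} \<and> length ms = r}"
    by (rule finite_lists_length_eq) simp
qed


text \<open>The complex numbers as a vector space over the rationals.\<close>

interpretation rat_complex: vector_space "\<lambda>(q::rat) (z::complex). of_rat q * z"
  by unfold_locales (simp_all add: algebra_simps of_rat_add of_rat_mult)


text \<open>The integral from \<open>\<i>\<close> to \<open>z\<close> is taken along the straight segment. The function is only
  used in the upper half-plane, which is convex, contains \<open>\<i>\<close> and avoids the singularities
  0, 1 and -1; there the integral does not depend on the path.\<close>

function polylog4 :: "nat list \<Rightarrow> complex \<Rightarrow> complex" where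
  "polylog4 [] z = 1"
| "polylog4 (ks @ [k]) z =
     (if k \<ge> 2
      then contour_integral (linepath \<i> z) (\<lambda>u. 1 / u * polylog4 (ks @ [k - 1]) u)
      else contour_integral (linepath \<i> z) (\<lambda>u. 2 / (1 - u\<^sup>2) * polylog4 ks u))"
proof -
  fix P :: bool and x :: "nat list \<times> complex"
  assume a: "\<And>z. x = ([], z) \<Longrightarrow> P" and b: "\<And>ks k z. x = (ks @ [k], z) \<Longrightarrow> P"
  obtain ls z where x: "x = (ls, z)" by (cases x)
  show P by (cases ls rule: rev_cases) (use a b x in auto)
qed auto
termination
  by (relation "Wellfounded.measure (\<lambda>(ks, z). sum_list ks + length ks)") auto

text \<open>Here \<open>tanh (t/2 + \<pi>\<i>/4) = (sinh t + \<i>) / cosh t\<close> runs along the unit circle from \<open>\<i>\<close> to 1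
  as \<open>t\<close> runs from 0 to infinity.\<close>

definition KT_lambda :: "nat list \<Rightarrow> complex \<Rightarrow> complex" where
  "KT_lambda ks s = 1 / Gamma s *
     (LINT t:{0<..}|lborel. complex_of_real t powr (s - 1) *
        polylog4 ks (tanh (complex_of_real t / 2 + complex_of_real pi * \<i> / 4)) /
        complex_of_real (cosh t))"


definition bounded_pairs :: "nat \<Rightarrow> (nat list \<times> nat) set" where
  "bounded_pairs w = {(ks, j). is_index ks \<and> wt ks + j \<le> w}"

lemma finite_bounded_pairs: "finite (bounded_pairs w)"
proof (rule finite_subset)
  have len: "length ks \<le> sum_list ks" if "is_index ks" for ks
    using that by (induction ks) (auto simp: is_index_def)
  show "bounded_pairs w \<subseteq> {ks. set ks \<subseteq> {..w} \<and> length ks \<le> w} \<times> {..w}"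
    using len member_le_sum_list by (fastforce simp: bounded_pairs_def wt_def)
  show "finite ({ks. set ks \<subseteq> {..w} \<and> length ks \<le> w} \<times> {..w})"
    by (intro finite_cartesian_product finite_lists_length_le) auto
qed

end

theory Submission imports Defs begin

text \<open>
  Put \<open>L(k; t) = 2\<^sup>r \<Sum> \<plusminus> e\<^bsup>-m\<^sub>r t\<^esup> / (m\<^sub>1\<^bsup>k\<^sub>1\<^esup> \<cdots> m\<^sub>r\<^bsup>k\<^sub>r\<^esup>)\<close>, summed as in \<open>T(k)\<close>. Lowering the last entry of \<open>k\<close> amounts
  to \<open>- d/dt\<close>, and a last entry 0 to the factor \<open>1 / cosh t\<close>. Along \<open>z(t) = tanh (t/2 + \<pi>\<i>/4)\<close> the
  polylogarithm satisfies, up to powers of \<open>\<i>\<close>, the same kind of differential equations, with value 0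
  at \<open>t = 0\<close>. Integrating by parts, induction on the weight writes it as a combination of the
  functions \<open>L(k'; t) t\<^sup>j / j!\<close>. The constants of integration are products of earlier coefficients
  with values \<open>T(k') = L(k'; 0+)\<close>; they stay in the right \<open>\<rat>\<close>-span because the functions \<open>L\<close>, and
  hence their limits, multiply by a shuffle product, which again follows by comparing derivatives.
  Finally the Mellin transform of \<open>L(k'; t) / cosh t\<close> at \<open>s + j\<close> is \<open>\<Gamma>(s + j) T(k', s + j)\<close>.
\<close>

section \<open>Nested sums\<close>

lemma is_index_Nil [simp]: "is_index []"
  by (simp add: is_index_def)

lemma is_index_Cons [simp]: "is_index (k # ks) \<longleftrightarrow> 1 \<le> k \<and> is_index ks"
  by (auto simp: is_index_def)

lemma is_index_rev [simp]: "is_index (rev ks) = is_index ks"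
  by (simp add: is_index_def)

lemma wt_Nil [simp]: "wt [] = 0"
  by (simp add: wt_def)

lemma wt_Cons [simp]: "wt (k # ks) = k + wt ks"
  by (simp add: wt_def)

lemma wt_rev [simp]: "wt (rev ks) = wt ks"
  by (simp add: wt_def sum_list_rev)

text \<open>Indices are stored reversed here: the head of the list is the exponent of the outermost
  variable. An exponent 0 is allowed in that position; \<open>nested_sum (0 # ks) m\<close> is the sum over the
  inner variables, to be divided by an arbitrary power of \<open>m\<close>.\<close>

fun nested_sum :: "nat list \<Rightarrow> nat \<Rightarrow> real" where
  "nested_sum [] m = (if m = 0 then 1 else 0)"
| "nested_sum (k # ks) m =
     (if 0 < m \<and> m mod 2 = Suc (length ks) mod 2 then (\<Sum>n<m. nested_sum ks n) / real m ^ k else 0)"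

lemma nested_sum_nonneg: "0 \<le> nested_sum ks m"
  by (induction ks arbitrary: m) (auto intro!: divide_nonneg_nonneg sum_nonneg)

lemma nested_sum_parity: "m mod 2 \<noteq> length ks mod 2 \<Longrightarrow> nested_sum ks m = 0"
  by (cases ks) auto

lemma nested_sum_less: "m < length ks \<Longrightarrow> nested_sum ks m = 0"
proof (induction ks arbitrary: m)
  case (Cons k ks)
  then have "(\<Sum>n<m. nested_sum ks n) = 0"
    by (intro sum.neutral) auto
  then show ?case by simp
qed simp

lemma sum_powr_le:
  fixes e :: real
  assumes "0 < e" "e \<le> 1"
  shows "(\<Sum>n<Suc m. real n powr (e - 1)) \<le> real m powr e / e"
proof (induction m)
  case (Suc m)
  have "real (Suc m) powr (e - 1) \<le> (real (Suc m) powr e - real m powr e) / e"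
  proof (cases "m = 0")
    case True
    then show ?thesis using assms by (simp add: field_simps)
  next
    case False
    have "\<exists>z>real m. z < real (Suc m) \<and>
        real (Suc m) powr e - real m powr e = (real (Suc m) - real m) * (e * z powr (e - 1))"
      using False by (intro MVT2) (auto intro!: derivative_eq_intros)
    then obtain z where z: "real m < z" "z < real (Suc m)"
        "real (Suc m) powr e - real m powr e = e * z powr (e - 1)"
      by auto
    have "real (Suc m) powr (e - 1) \<le> z powr (e - 1)"
      using z False assms by (intro powr_mono2') auto
    then show ?thesis using z(3) assms by simp
  qed
  then show ?case using Suc.IH by (simp add: diff_divide_distrib)
qed (use assms in simp)

lemma nested_sum_bound:
  assumes "is_index ks" and e: "0 < e" "e \<le> (1::real)"
  obtains C where "0 \<le> C" "\<And>m. 1 \<le> m \<Longrightarrow> nested_sum ks m \<le> C * real m powr (e - 1)"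
    and "\<And>m. 1 \<le> m \<Longrightarrow> (\<Sum>n<m. nested_sum ks n) \<le> C * real m powr e"
proof -
  have "\<exists>C\<ge>0. (\<forall>m\<ge>1. nested_sum ks m \<le> C * real m powr (e - 1)) \<and>
              (\<forall>m\<ge>1. (\<Sum>n<m. nested_sum ks n) \<le> C * real m powr e)"
    using assms(1)
  proof (induction ks)
    case Nil
    have "(\<Sum>n<m. nested_sum [] n) \<le> 1 * real m powr e" if "1 \<le> m" for m
    proof -
      have "(\<Sum>n<m. nested_sum [] n) = 1"
        using that by (simp add: sum.If_cases)
      then show ?thesis using that e by (simp add: ge_one_powr_ge_zero)
    qed
    then show ?case by (intro exI[of _ 1]) auto
  next
    case (Cons k ks)
    then obtain C where C: "0 \<le> C" "\<And>m. 1 \<le> m \<Longrightarrow> (\<Sum>n<m. nested_sum ks n) \<le> C * real m powr e"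
      by auto
    have 1: "nested_sum (k # ks) m \<le> C * real m powr (e - 1)" for m
    proof (cases "0 < m \<and> m mod 2 = Suc (length ks) mod 2")
      case True
      then have m: "1 \<le> m" by simp
      have "nested_sum (k # ks) m = (\<Sum>n<m. nested_sum ks n) / real m ^ k"
        using True by simp
      also have "\<dots> \<le> (\<Sum>n<m. nested_sum ks n) / real m ^ 1"
        using Cons.prems m
        by (intro divide_left_mono power_increasing mult_pos_pos sum_nonneg nested_sum_nonneg) auto
      also have "\<dots> \<le> C * real m powr e / real m"
        using C(2)[OF m] m by (simp add: divide_right_mono)
      also have "\<dots> = C * real m powr (e - 1)"
        using m by (simp add: powr_diff)
      finally show ?thesis .
    qed (use C in auto)
    have 2: "(\<Sum>n<m. nested_sum (k # ks) n) \<le> C / e * real m powr e" for m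
    proof -
      have "(\<Sum>n<m. nested_sum (k # ks) n) \<le> (\<Sum>n<Suc m. nested_sum (k # ks) n)"
        using nested_sum_nonneg[of "k # ks" m] by simp
      also have "\<dots> \<le> (\<Sum>n<Suc m. C * real n powr (e - 1))"
        using 1 by (rule sum_mono)
      also have "\<dots> = C * (\<Sum>n<Suc m. real n powr (e - 1))"
        by (rule sum_distrib_left [symmetric])
      also have "\<dots> \<le> C * (real m powr e / e)"
        using C(1) sum_powr_le[OF e] by (intro mult_left_mono)
      finally show ?thesis by simp
    qed
    have "C \<le> C / e" using C e by (simp add: field_simps mult_left_le)
    then have "C * real m powr (e - 1) \<le> C / e * real m powr (e - 1)" for m
      by (intro mult_right_mono) auto
    then have "nested_sum (k # ks) m \<le> C / e * real m powr (e - 1)" for m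
      using 1 order_trans by blast
    moreover have "0 \<le> C / e" using C e by simp
    ultimately show ?case using 2 by blast
  qed
  then show ?thesis using that by blast
qed

definition tcoeff :: "nat list \<Rightarrow> nat \<Rightarrow> real" where
  "tcoeff ks m = 2 ^ length ks * (-1) ^ ((m - length ks) div 2) * nested_sum ks m"

definition tval :: "nat list \<Rightarrow> real" where
  "tval ks = (\<Sum>m. tcoeff ks m)"

definition tser :: "nat list \<Rightarrow> real \<Rightarrow> real" where
  "tser ks t = (\<Sum>m. tcoeff ks m * exp (-t) ^ m)"

lemma tcoeff_0: "ks \<noteq> [] \<Longrightarrow> tcoeff ks 0 = 0"
  by (cases ks) (auto simp: tcoeff_def)

lemma tcoeff_Nil: "tcoeff [] m = (if m = 0 then 1 else 0)"
  by (simp add: tcoeff_def)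

lemma abs_tcoeff: "\<bar>tcoeff ks m\<bar> = 2 ^ length ks * nested_sum ks m"
  by (simp add: tcoeff_def abs_mult nested_sum_nonneg power_abs)

lemma tcoeff_Suc: "tcoeff (Suc k # ks) m * real m = tcoeff (k # ks) m"
  by (auto simp: tcoeff_def)

lemma tcoeff_power: "tcoeff (k # ks) m * real m ^ k = tcoeff (0 # ks) m"
  by (auto simp: tcoeff_def)

lemma tcoeff_zero_Suc_0: "tcoeff (0 # ks) (Suc 0) = 2 * tcoeff ks 0"
  by (cases ks) (auto simp: tcoeff_def)

lemma nested_sum_zero:
  "m mod 2 = Suc (length ks) mod 2 \<Longrightarrow> nested_sum (0 # ks) m = (\<Sum>n<m. nested_sum ks n)"
  by (cases "m = 0") simp_all

text \<open>Multiplication of the generating series by \<open>2 cosh t\<close>, coefficientwise.\<close>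

lemma tcoeff_zero_rec: "tcoeff (0 # ks) (Suc (Suc m)) + tcoeff (0 # ks) m = 2 * tcoeff ks (Suc m)"
proof (cases "m mod 2 = Suc (length ks) mod 2")
  case False
  then have "nested_sum ks (Suc m) = 0"
    by (intro nested_sum_parity) presburger
  moreover have "nested_sum (0 # ks) m = 0" "nested_sum (0 # ks) (Suc (Suc m)) = 0"
    using False by (auto intro!: nested_sum_parity simp del: nested_sum.simps)
  ultimately show ?thesis
    by (simp add: tcoeff_def del: nested_sum.simps)
next
  case par: True
  define r where "r = length ks"
  have A: "nested_sum (0 # ks) m = (\<Sum>n<m. nested_sum ks n)"
    by (rule nested_sum_zero) fact
  have "nested_sum ks m = 0"
    using par by (intro nested_sum_parity) presburger
  moreover have "nested_sum (0 # ks) (Suc (Suc m)) = (\<Sum>n<Suc (Suc m). nested_sum ks n)"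
    using par by (intro nested_sum_zero) simp
  ultimately have B: "nested_sum (0 # ks) (Suc (Suc m)) = (\<Sum>n<m. nested_sum ks n) + nested_sum ks (Suc m)"
    by simp
  show ?thesis
  proof (cases "r < m")
    case True
    have "Suc (Suc m) - length (0 # ks) = Suc (Suc (m - Suc r))"
      "m - length (0 # ks) = m - Suc r" "Suc m - length ks = Suc (Suc (m - Suc r))"
      using True by (simp_all add: r_def)
    then show ?thesis
      unfolding tcoeff_def A B by (simp add: algebra_simps)
  next
    case False
    then have "(\<Sum>n<m. nested_sum ks n) = 0"
      by (intro sum.neutral) (auto simp: nested_sum_less r_def)
    then show ?thesis
      unfolding tcoeff_def A B by simp
  qed
qed

lemma tcoeff_bound:
  assumes "is_index ks" "0 < e" "e \<le> (1::real)"
  obtains C where "0 \<le> C" "\<And>m. 1 \<le> m \<Longrightarrow> \<bar>tcoeff ks m\<bar> \<le> C * real m powr (e - 1)"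
    "\<And>m. \<bar>tcoeff (0 # ks) m\<bar> \<le> C * real m powr e"
proof -
  obtain C where C: "0 \<le> C" "\<And>m. 1 \<le> m \<Longrightarrow> nested_sum ks m \<le> C * real m powr (e - 1)"
    "\<And>m. 1 \<le> m \<Longrightarrow> (\<Sum>n<m. nested_sum ks n) \<le> C * real m powr e"
    using nested_sum_bound[OF assms] by metis
  show ?thesis
  proof (rule that[of "2 ^ Suc (length ks) * C"])
    fix m :: nat
    have "\<bar>tcoeff ks m\<bar> \<le> 2 ^ Suc (length ks) * nested_sum ks m"
      unfolding abs_tcoeff by (intro mult_right_mono nested_sum_nonneg) simp
    also have "\<dots> \<le> 2 ^ Suc (length ks) * (C * real m powr (e - 1))" if "1 \<le> m"
      using C(2)[OF that] by (intro mult_left_mono) auto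
    finally show "1 \<le> m \<Longrightarrow> \<bar>tcoeff ks m\<bar> \<le> 2 ^ Suc (length ks) * C * real m powr (e - 1)"
      by (simp only: mult.assoc)
    show "\<bar>tcoeff (0 # ks) m\<bar> \<le> 2 ^ Suc (length ks) * C * real m powr e"
      using C(1) C(3)[of m] by (auto simp: abs_tcoeff)
  qed (use C in auto)
qed

lemma abs_tcoeff_le_zero: "\<bar>tcoeff (k # ks) m\<bar> \<le> \<bar>tcoeff (0 # ks) m\<bar>"
proof (cases "m = 0")
  case False
  have "\<bar>tcoeff (k # ks) m\<bar> * 1 \<le> \<bar>tcoeff (k # ks) m\<bar> * real m ^ k"
    by (rule mult_left_mono) (use False in \<open>simp_all add: one_le_power\<close>)
  also have "\<dots> = \<bar>tcoeff (k # ks) m * real m ^ k\<bar>"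
    by (simp add: abs_mult)
  also have "\<dots> = \<bar>tcoeff (0 # ks) m\<bar>"
    by (simp only: tcoeff_power)
  finally show ?thesis by simp
qed (simp add: tcoeff_0)

lemma summable_tcoeff_power:
  assumes "is_index ks" "\<bar>q\<bar> < 1"
  shows "summable (\<lambda>m. tcoeff (k # ks) m * q ^ m)"
proof -
  obtain C where C: "0 \<le> C" "\<And>m. \<bar>tcoeff (0 # ks) m\<bar> \<le> C * real m powr 1"
    using tcoeff_bound[OF assms(1) zero_less_one order_refl] by metis
  have "summable (\<lambda>m. diffs (\<lambda>_. 1) m * \<bar>q\<bar> ^ m)"
    by (rule termdiff_converges[where K = 1]) (use assms in \<open>auto intro: summable_geometric\<close>)
  then have "summable (\<lambda>m. real (Suc m) * \<bar>q\<bar> ^ m)"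
    by (simp add: diffs_def)
  then have "summable (\<lambda>m. \<bar>q\<bar> * (real (Suc m) * \<bar>q\<bar> ^ m))"
    by (rule summable_mult)
  then have "summable (\<lambda>m. real (Suc m) * \<bar>q\<bar> ^ Suc m)"
    by (simp only: power_Suc mult.left_commute)
  then have "summable (\<lambda>m. real m * \<bar>q\<bar> ^ m)"
    by (subst (asm) summable_Suc_iff)
  then have s: "summable (\<lambda>m. C * (real m * \<bar>q\<bar> ^ m))"
    by (rule summable_mult)
  show ?thesis
  proof (rule summable_comparison_test'[OF s])
    fix m :: nat
    have "\<bar>tcoeff (k # ks) m\<bar> \<le> C * real m"
      using C(2)[of m] abs_tcoeff_le_zero[of k ks m] by auto
    then have "\<bar>tcoeff (k # ks) m\<bar> * \<bar>q\<bar> ^ m \<le> C * real m * \<bar>q\<bar> ^ m"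
      by (rule mult_right_mono) simp
    then show "norm (tcoeff (k # ks) m * q ^ m) \<le> C * (real m * \<bar>q\<bar> ^ m)"
      by (simp add: abs_mult power_abs mult.assoc)
  qed
qed

section \<open>Generating series in $e^{-t}$\<close>

lemma summable_of_pair_sums:
  fixes a :: "nat \<Rightarrow> real"
  assumes "a \<longlonglongrightarrow> 0" and "summable (\<lambda>m. a (Suc (Suc m)) + a m)"
  shows "summable a"
proof -
  have eq: "(\<Sum>m<n. a (Suc (Suc m)) + a m) = 2 * (\<Sum>m<n. a m) - a 0 - a 1 + a n + a (Suc n)" for n
    by (induction n) simp_all
  have "(\<lambda>n. (\<Sum>m<n. a (Suc (Suc m)) + a m) + a 0 + a 1 - a n - a (Suc n))
      \<longlonglongrightarrow> (\<Sum>m. a (Suc (Suc m)) + a m) + a 0 + a 1 - 0 - 0"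
    by (intro tendsto_intros assms(1) filterlim_compose[OF assms(1)] filterlim_Suc summable_LIMSEQ assms(2))
  then have "(\<lambda>n. 2 * (\<Sum>m<n. a m)) \<longlonglongrightarrow> (\<Sum>m. a (Suc (Suc m)) + a m) + a 0 + a 1"
    unfolding eq by simp
  then have "(\<lambda>n. (\<Sum>m<n. a m)) \<longlonglongrightarrow> ((\<Sum>m. a (Suc (Suc m)) + a m) + a 0 + a 1) / 2"
    using tendsto_divide[OF _ tendsto_const, of "\<lambda>n. 2 * (\<Sum>m<n. a m)" _ sequentially "2"] by simp
  then show ?thesis
    unfolding summable_def sums_def by blast
qed

text \<open>An instance of Abel's theorem: multiplying by \<open>1 + q\<^sup>2\<close> makes the series absolutely convergent
  at \<open>q = 1\<close>.\<close>

lemma powser_tendsto_of_pair_sums: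
  fixes a :: "nat \<Rightarrow> real"
  assumes lim: "a \<longlonglongrightarrow> 0" and s: "summable (\<lambda>m. \<bar>a (Suc (Suc m)) + a m\<bar>)"
    and p: "\<And>q. \<bar>q\<bar> < 1 \<Longrightarrow> summable (\<lambda>m. a m * q ^ m)"
  shows "((\<lambda>q. \<Sum>m. a m * q ^ m) \<longlongrightarrow> (\<Sum>m. a m)) (at_left 1)"
proof -
  have sa: "summable a"
    using lim summable_rabs_cancel[OF s] by (rule summable_of_pair_sums)
  define D where "D q = (\<Sum>m. (a (Suc (Suc m)) + a m) * q ^ Suc (Suc m))" for q
  have bd: "norm ((a (Suc (Suc m)) + a m) * q ^ Suc (Suc m)) \<le> \<bar>a (Suc (Suc m)) + a m\<bar>"
    if "q \<in> {0..1}" for q m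
  proof -
    have "q ^ Suc (Suc m) \<le> 1" "0 \<le> q ^ Suc (Suc m)"
      using that by (intro power_le_one zero_le_power; simp)+
    then show ?thesis
      by (simp only: real_norm_def abs_mult abs_of_nonneg mult_left_le abs_ge_zero)
  qed
  have cont: "continuous_on {0..1} D"
    unfolding D_def
    by (rule uniform_limit_theorem[OF _ Weierstrass_m_test[OF bd s]])
       (auto intro!: always_eventually continuous_intros)
  have eq: "(\<Sum>m. a m * q ^ m) = (a 0 + a 1 * q + D q) / (1 + q\<^sup>2)" if q: "q \<in> {0..1}" for q
  proof -
    define A where "A = (\<Sum>m. a m * q ^ m)"
    have "summable (\<lambda>m. a m * q ^ m)"
      using p[of q] sa q by (cases "q = 1") auto
    then have 1: "(\<lambda>m. a m * q ^ m) sums A"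
      by (simp add: A_def summable_sums)
    then have "(\<lambda>m. a (Suc m) * q ^ Suc m) sums (A - a 0)"
      by (subst sums_Suc_iff) simp
    then have "(\<lambda>m. a (Suc (Suc m)) * q ^ Suc (Suc m)) sums (A - a 0 - a 1 * q)"
      by (subst sums_Suc_iff[where f = "\<lambda>m. a (Suc m) * q ^ Suc m"]) simp
    from sums_add[OF this sums_mult[OF 1, of "q\<^sup>2"]]
    have "(\<lambda>m. (a (Suc (Suc m)) + a m) * q ^ Suc (Suc m)) sums (A - a 0 - a 1 * q + q\<^sup>2 * A)"
      by (simp add: algebra_simps power2_eq_square)
    then have "D q = A - a 0 - a 1 * q + q\<^sup>2 * A"
      unfolding D_def by (rule sums_unique[symmetric])
    moreover have "1 + q\<^sup>2 \<noteq> 0" by (metis add_pos_nonneg less_numeral_extra(1) less_irrefl zero_le_power2)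
    ultimately show ?thesis unfolding A_def[symmetric] by (simp add: field_simps)
  qed
  have "continuous_on {0..1} (\<lambda>q. (a 0 + a 1 * q + D q) / (1 + q\<^sup>2))"
    by (intro continuous_intros cont) (metis add_pos_nonneg less_numeral_extra(1) less_irrefl zero_le_power2)
  then have "continuous_on {0..1} (\<lambda>q. \<Sum>m. a m * q ^ m)"
    by (rule continuous_on_eq) (simp add: eq)
  then have "((\<lambda>q. \<Sum>m. a m * q ^ m) \<longlongrightarrow> (\<Sum>m. a m * 1 ^ m)) (at 1 within {0..1})"
    unfolding continuous_on_def by (rule bspec) simp
  moreover have "at (1::real) within {0..1} = at_left 1"
    by (rule at_within_Icc_at_left) simp
  ultimately show ?thesis by simp
qed

lemma summable_tcoeff_power':
  assumes "is_index ks" "\<bar>q\<bar> < 1"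
  shows "summable (\<lambda>m. tcoeff ks m * q ^ m)"
proof (cases ks)
  case Nil
  then show ?thesis
    by (intro summable_finite[of "{0}"]) (auto simp: tcoeff_Nil)
qed (use assms summable_tcoeff_power in simp)

lemma tser_Nil [simp]: "tser [] t = 1"
proof -
  have "(\<lambda>m. tcoeff [] m * exp (-t) ^ m) sums (\<Sum>m\<in>{0}. tcoeff [] m * exp (-t) ^ m)"
    by (rule sums_finite) (auto simp: tcoeff_Nil)
  then show ?thesis unfolding tser_def by (simp add: sums_iff tcoeff_Nil)
qed

lemma tval_Nil [simp]: "tval [] = 1"
proof -
  have "(\<lambda>m. tcoeff [] m) sums (\<Sum>m\<in>{0}. tcoeff [] m)"
    by (rule sums_finite) (auto simp: tcoeff_Nil)
  moreover have "(\<Sum>m\<in>{0}. tcoeff [] m) = 1" by (simp add: tcoeff_Nil)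
  ultimately show ?thesis unfolding tval_def using sums_unique by metis
qed

lemma DERIV_tser:
  assumes "is_index ks" "0 < t"
  shows "(tser (Suc k # ks) has_real_derivative - tser (k # ks) t) (at t)"
proof -
  let ?c = "tcoeff (Suc k # ks)"
  define q where "q = exp (-t)"
  have q: "\<bar>q\<bar> < 1" using assms by (simp add: q_def)
  have D: "((\<lambda>q. \<Sum>m. ?c m * q ^ m) has_real_derivative (\<Sum>m. diffs ?c m * q ^ m)) (at q)"
    using q by (intro termdiffs_strong'[where K = 1] summable_tcoeff_power assms) auto
  have "(\<lambda>m. tcoeff (k # ks) m * q ^ m) sums tser (k # ks) t"
    unfolding tser_def q_def[symmetric]
    by (intro summable_sums summable_tcoeff_power assms q)
  then have "(\<lambda>m. tcoeff (k # ks) (Suc m) * q ^ Suc m) sums tser (k # ks) t"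
    by (subst sums_Suc_iff) (simp add: tcoeff_0)
  moreover have e: "tcoeff (k # ks) (Suc m) * q ^ Suc m = diffs ?c m * q ^ m * q" for m
    unfolding diffs_def tcoeff_Suc[of k, symmetric] by (simp add: mult_ac)
  ultimately have "(\<lambda>m. diffs ?c m * q ^ m * q) sums tser (k # ks) t"
    by (simp only: e)
  moreover have "summable (\<lambda>m. diffs ?c m * q ^ m)"
    using q by (intro termdiff_converges[where K = 1] summable_tcoeff_power assms) auto
  ultimately have eq: "(\<Sum>m. diffs ?c m * q ^ m) * q = tser (k # ks) t"
    using sums_unique suminf_mult2 by metis
  have "((\<lambda>t. \<Sum>m. ?c m * exp (-t) ^ m) has_real_derivative (\<Sum>m. diffs ?c m * q ^ m) * - q) (at t)"
    by (rule DERIV_chain2[where f = "\<lambda>q. \<Sum>m. ?c m * q ^ m"]) 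
      (use D in \<open>auto intro!: derivative_eq_intros simp: q_def\<close>)
  then show ?thesis
    using eq by (simp add: tser_def[abs_def])
qed

lemma tser_zero:
  assumes "is_index ks" "0 < t"
  shows "tser (0 # ks) t = tser ks t / cosh t"
proof -
  define q where "q = exp (-t)"
  define X where "X = tser (0 # ks) t"
  define Y where "Y = tser ks t"
  have q: "\<bar>q\<bar> < 1" "0 < q" using assms by (simp_all add: q_def)
  have 1: "(\<lambda>m. tcoeff (0 # ks) m * q ^ m) sums X"
    unfolding tser_def q_def[symmetric] X_def by (intro summable_sums summable_tcoeff_power assms q)
  then have "(\<lambda>m. tcoeff (0 # ks) (Suc m) * q ^ Suc m) sums X"
    by (subst sums_Suc_iff) (simp add: tcoeff_0)
  then have "(\<lambda>m. tcoeff (0 # ks) (Suc (Suc m)) * q ^ Suc (Suc m)) sums (X - 2 * tcoeff ks 0 * q)"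
    by (subst sums_Suc_iff[where f = "\<lambda>m. tcoeff (0 # ks) (Suc m) * q ^ Suc m"]) (simp add: tcoeff_zero_Suc_0)
  from sums_add[OF this sums_mult[OF 1, of "q\<^sup>2"]]
  have "(\<lambda>m. (tcoeff (0 # ks) (Suc (Suc m)) + tcoeff (0 # ks) m) * q ^ Suc (Suc m)) sums
      (X - 2 * tcoeff ks 0 * q + q\<^sup>2 * X)"
    by (simp add: algebra_simps power2_eq_square)
  then have L: "(\<lambda>m. 2 * q * (tcoeff ks (Suc m) * q ^ Suc m)) sums (X - 2 * tcoeff ks 0 * q + q\<^sup>2 * X)"
    unfolding tcoeff_zero_rec by (simp add: mult_ac)
  have "(\<lambda>m. tcoeff ks m * q ^ m) sums Y"
    unfolding tser_def q_def[symmetric] Y_def by (intro summable_sums summable_tcoeff_power' assms q)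
  then have "(\<lambda>m. tcoeff ks (Suc m) * q ^ Suc m) sums (Y - tcoeff ks 0)"
    by (subst sums_Suc_iff) simp
  from sums_mult[OF this, of "2 * q"] L
  have "X - 2 * tcoeff ks 0 * q + q\<^sup>2 * X = 2 * q * (Y - tcoeff ks 0)"
    using sums_unique2 by blast
  then have eq: "X * (1 + q\<^sup>2) = 2 * q * Y" by (simp add: algebra_simps)
  have "cosh t = (1 + q\<^sup>2) / (2 * q)"
    by (simp add: cosh_def q_def exp_minus field_simps power2_eq_square)
  then have "X * cosh t = X * (1 + q\<^sup>2) / (2 * q)" by simp
  also have "\<dots> = Y" unfolding eq using q by simp
  finally show ?thesis
    unfolding X_def[symmetric] Y_def[symmetric] by (simp add: eq_divide_eq)
qed

lemma tcoeff_tendsto_0: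
  assumes "is_index ks"
  shows "tcoeff ks \<longlonglongrightarrow> 0"
proof -
  have half: "0 < (1/2::real)" "(1/2::real) \<le> 1" by simp_all
  obtain C where C: "0 \<le> C" "\<And>m. 1 \<le> m \<Longrightarrow> \<bar>tcoeff ks m\<bar> \<le> C * real m powr (1/2 - 1)"
    using tcoeff_bound[OF assms half] by metis
  have "(\<lambda>m. C * real m powr (1/2 - 1)) \<longlonglongrightarrow> 0"
    by (intro tendsto_mult_right_zero tendsto_neg_powr filterlim_real_sequentially) simp
  then show ?thesis
    by (rule Lim_null_comparison[rotated])
       (use C in \<open>auto intro!: eventually_sequentiallyI[of 1]\<close>)
qed

lemma summable_tcoeff_pairs:
  assumes "is_index (k # ks)"
  shows "summable (\<lambda>m. \<bar>tcoeff (k # ks) (Suc (Suc m)) + tcoeff (k # ks) m\<bar>)"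
proof (cases "k = 1")
  case True
  have half: "0 < (1/2::real)" "(1/2::real) \<le> 1" and idx: "is_index (1 # ks)" "is_index ks"
    using assms by simp_all
  obtain C where C: "0 \<le> C" "\<And>m. 1 \<le> m \<Longrightarrow> \<bar>tcoeff (1 # ks) m\<bar> \<le> C * real m powr (1/2 - 1)"
    using tcoeff_bound[OF idx(1) half] by metis
  obtain B where B: "0 \<le> B" "\<And>m. 1 \<le> m \<Longrightarrow> \<bar>tcoeff ks m\<bar> \<le> B * real m powr (1/2 - 1)"
    using tcoeff_bound[OF idx(2) half] by metis
  have s: "summable (\<lambda>m. 2 * (B + C) * real m powr (- 3/2))"
    by (intro summable_mult) (simp add: summable_real_powr_iff)
  show ?thesis
  proof (rule summable_comparison_test'[OF s, of 1])
    fix m :: nat assume m: "m \<ge> 1"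
    have mono: "real n powr (1/2 - 1) \<le> real m powr (1/2 - 1)" if "m \<le> n" for n
      using m that by (intro powr_mono2') auto
    have t1: "tcoeff (1 # ks) n * real n = tcoeff (0 # ks) n" for n
      using tcoeff_Suc[of 0 ks n] by simp
    have "(tcoeff (1 # ks) (Suc (Suc m)) + tcoeff (1 # ks) m) * real m =
        tcoeff (1 # ks) (Suc (Suc m)) * real (Suc (Suc m)) + tcoeff (1 # ks) m * real m
          - 2 * tcoeff (1 # ks) (Suc (Suc m))"
      by (simp add: algebra_simps)
    also have "\<dots> = 2 * tcoeff ks (Suc m) - 2 * tcoeff (1 # ks) (Suc (Suc m))"
      by (simp only: t1 tcoeff_zero_rec)
    finally have "\<bar>tcoeff (1 # ks) (Suc (Suc m)) + tcoeff (1 # ks) m\<bar> * real m =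
        \<bar>2 * tcoeff ks (Suc m) - 2 * tcoeff (1 # ks) (Suc (Suc m))\<bar>"
      by (metis abs_mult abs_of_nat)
    also have "\<dots> \<le> 2 * (\<bar>tcoeff ks (Suc m)\<bar> + \<bar>tcoeff (1 # ks) (Suc (Suc m))\<bar>)"
      using abs_triangle_ineq4[of "2 * tcoeff ks (Suc m)" "2 * tcoeff (1 # ks) (Suc (Suc m))"]
      by (simp add: abs_mult)
    also have "\<dots> \<le> 2 * (B * real m powr (1/2 - 1) + C * real m powr (1/2 - 1))"
      by (intro mult_left_mono add_mono order_trans[OF B(2) mult_left_mono[OF mono B(1)]]
            order_trans[OF C(2) mult_left_mono[OF mono C(1)]]) simp_all
    finally have "\<bar>tcoeff (1 # ks) (Suc (Suc m)) + tcoeff (1 # ks) m\<bar>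
        \<le> 2 * (B * real m powr (1/2 - 1) + C * real m powr (1/2 - 1)) / real m"
      using m by (simp add: pos_le_divide_eq)
    also have "\<dots> = 2 * (B + C) * (real m powr (1/2 - 1) / real m powr 1)"
      using m by (simp add: algebra_simps add_divide_distrib)
    also have "\<dots> = 2 * (B + C) * real m powr (- 3/2)"
      by (simp only: powr_diff[symmetric]) simp
    finally show "norm \<bar>tcoeff (k # ks) (Suc (Suc m)) + tcoeff (k # ks) m\<bar> \<le> 2 * (B + C) * real m powr (- 3/2)"
      using True by simp
  qed
next
  case False
  have half: "0 < (1/2::real)" "(1/2::real) \<le> 1" and idx: "is_index ks"
    using assms by simp_all
  obtain C where C: "0 \<le> C" "\<And>m. \<bar>tcoeff (0 # ks) m\<bar> \<le> C * real m powr (1/2)"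
    using tcoeff_bound[OF idx half] by metis
  have s: "summable (\<lambda>m. C * real m powr (- 3/2))"
    by (intro summable_mult) (simp add: summable_real_powr_iff)
  have "summable (\<lambda>m. \<bar>tcoeff (k # ks) m\<bar>)"
  proof (rule summable_comparison_test'[OF s, of 1])
    fix m :: nat assume m: "m \<ge> 1"
    have "\<bar>tcoeff (k # ks) m\<bar> * real m ^ 2 \<le> \<bar>tcoeff (k # ks) m\<bar> * real m ^ k"
      using m False assms by (intro mult_left_mono power_increasing) auto
    also have "\<dots> = \<bar>tcoeff (0 # ks) m\<bar>"
      by (metis abs_mult abs_of_nat of_nat_power tcoeff_power)
    finally have "\<bar>tcoeff (k # ks) m\<bar> \<le> C * real m powr (1/2) / real m ^ 2"
      using C(2)[of m] m by (simp add: pos_le_divide_eq)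
    also have "\<dots> = C * (real m powr (1/2) / real m powr 2)"
      using m by simp
    also have "\<dots> = C * real m powr (- 3/2)"
      by (simp only: powr_diff[symmetric]) simp
    finally show "norm \<bar>tcoeff (k # ks) m\<bar> \<le> C * real m powr (- 3/2)" by simp
  qed
  moreover from this have "summable (\<lambda>m. \<bar>tcoeff (k # ks) (Suc (Suc m))\<bar>)"
    by (subst summable_Suc_iff[of "\<lambda>m. \<bar>tcoeff (k # ks) (Suc m)\<bar>"], subst summable_Suc_iff)
  ultimately have s: "summable (\<lambda>m. \<bar>tcoeff (k # ks) (Suc (Suc m))\<bar> + \<bar>tcoeff (k # ks) m\<bar>)"
    by (intro summable_add)
  show ?thesis
    by (rule summable_comparison_test'[OF s, of 0]) (simp add: abs_triangle_ineq)
qed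

lemma summable_tcoeff:
  assumes "is_index ks"
  shows "summable (tcoeff ks)"
proof (cases ks)
  case Nil
  then show ?thesis
    by (intro summable_finite[of "{0}"]) (auto simp: tcoeff_Nil)
next
  case (Cons k ls)
  then show ?thesis
    using assms
    by (simp add: summable_of_pair_sums[OF tcoeff_tendsto_0 summable_rabs_cancel[OF summable_tcoeff_pairs]])
qed

lemma tser_tendsto_tval:
  assumes "is_index ks"
  shows "(tser ks \<longlongrightarrow> tval ks) (at_right 0)"
proof (cases ks)
  case Nil
  then show ?thesis
    by (simp add: tser_Nil[abs_def])
next
  case (Cons k ls)
  have *: "((\<lambda>q. \<Sum>m. tcoeff ks m * q ^ m) \<longlongrightarrow> tval ks) (at_left 1)"
    unfolding tval_def
    using assms Cons by (intro powser_tendsto_of_pair_sums tcoeff_tendsto_0 summable_tcoeff_power')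
      (simp_all add: summable_tcoeff_pairs)
  have "filterlim (\<lambda>t. exp (-t) :: real) (at_left 1) (at_right 0)"
    unfolding filterlim_at
  proof
    show "\<forall>\<^sub>F t in at_right 0. exp (- t) \<in> {..<1::real} \<and> exp (- t) \<noteq> (1::real)"
      by (auto simp: eventually_at_right_less intro!: eventually_at_rightI[of 0 1])
    have "((\<lambda>t. exp (- t)) \<longlongrightarrow> exp (- 0 :: real)) (at_right 0)"
      by (intro tendsto_intros)
    then show "((\<lambda>t. exp (- t)) \<longlongrightarrow> (1::real)) (at_right 0)" by simp
  qed
  from filterlim_compose[OF * this] show ?thesis
    by (simp add: tser_def[abs_def])
qed

lemma tser_tendsto_0:
  assumes "is_index ks"
  shows "(tser (k # ks) \<longlongrightarrow> 0) at_top"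
proof -
  have s: "summable (\<lambda>m. tcoeff (k # ks) m * (1/2) ^ m)"
    using assms by (intro summable_tcoeff_power) auto
  have "isCont (\<lambda>q. \<Sum>m. tcoeff (k # ks) m * q ^ m) 0"
    by (rule isCont_powser[OF s]) simp
  moreover have "((\<lambda>t. exp (-t) :: real) \<longlongrightarrow> 0) at_top"
    by (rule filterlim_compose[OF exp_at_bot filterlim_uminus_at_bot_at_top])
  ultimately have "((\<lambda>t. \<Sum>m. tcoeff (k # ks) m * exp (-t) ^ m) \<longlongrightarrow> (\<Sum>m. tcoeff (k # ks) m * 0 ^ m)) at_top"
    by (rule isCont_tendsto_compose)
  then show ?thesis
    by (simp add: tser_def[abs_def] tcoeff_0)
qed

section \<open>Values and Mellin transforms\<close>

lemma last_sorted_less_iff: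
  fixes ns :: "nat list"
  assumes "sorted_wrt (<) ns" "ns \<noteq> []"
  shows "(\<forall>y\<in>set ns. y < m) \<longleftrightarrow> last ns < m"
proof (cases ns rule: rev_cases)
  case (snoc xs x)
  then show ?thesis using assms by (force simp: sorted_wrt_append)
qed (use assms in simp)

lemma Ttilde_seqs_Suc_0: "Ttilde_seqs (Suc 0) m = (if odd m then {[m]} else {})"
  by (auto simp: Ttilde_seqs_def length_Suc_conv odd_iff_mod_2_eq_one)

lemma Ttilde_seqs_Suc:
  assumes "0 < r"
  shows "Ttilde_seqs (Suc r) m =
    (if 0 < m \<and> m mod 2 = Suc r mod 2 then (\<lambda>ns. ns @ [m]) ` (\<Union>n<m. Ttilde_seqs r n) else {})"
proof -
  have A: "ms \<in> Ttilde_seqs (Suc r) m \<longleftrightarrow>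
      (\<exists>ns. ms = ns @ [m] \<and> 0 < m \<and> m mod 2 = Suc r mod 2 \<and> last ns < m \<and> ns \<in> Ttilde_seqs r (last ns))" for ms
  proof (cases ms rule: rev_cases)
    case Nil
    then show ?thesis by (simp add: Ttilde_seqs_def)
  next
    case (snoc ns x)
    have "(\<forall>j<r. 0 < (ns @ [x]) ! j \<and> (ns @ [x]) ! j mod 2 = Suc j mod 2) \<longleftrightarrow>
        (\<forall>j<r. 0 < ns ! j \<and> ns ! j mod 2 = Suc j mod 2)" if "length ns = r"
      using that by (auto simp: nth_append)
    then show ?thesis
      using snoc assms last_sorted_less_iff[of ns x]
      by (auto simp: Ttilde_seqs_def sorted_wrt_append All_less_Suc nth_append)
        (metis gr0I gr_implies_not0 hd_in_set)
  qed
  have L: "last ns = n" if "ns \<in> Ttilde_seqs r n" for ns n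
    using that by (simp add: Ttilde_seqs_def)
  show ?thesis
  proof (cases "0 < m \<and> m mod 2 = Suc r mod 2")
    case True
    have "Ttilde_seqs (Suc r) m = (\<lambda>ns. ns @ [m]) ` (\<Union>n<m. Ttilde_seqs r n)"
    proof (intro equalityI subsetI)
      fix ms assume "ms \<in> Ttilde_seqs (Suc r) m"
      then show "ms \<in> (\<lambda>ns. ns @ [m]) ` (\<Union>n<m. Ttilde_seqs r n)"
        unfolding A by blast
    next
      fix ms assume "ms \<in> (\<lambda>ns. ns @ [m]) ` (\<Union>n<m. Ttilde_seqs r n)"
      then obtain ns n where "ms = ns @ [m]" "n < m" "ns \<in> Ttilde_seqs r n" by blast
      then show "ms \<in> Ttilde_seqs (Suc r) m"
        unfolding A using True L[of ns n] by blast
    qed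
    then show ?thesis using True by simp
  next
    case False
    then show ?thesis using A by auto
  qed
qed

definition powr_prod :: "complex list \<Rightarrow> nat list \<Rightarrow> complex" where
  "powr_prod cs ms = (\<Prod>j<length cs. of_nat (ms ! j) powr (cs ! j))"

lemma powr_prod_snoc:
  assumes "length ms = length cs"
  shows "powr_prod (cs @ [s]) (ms @ [m]) = powr_prod cs ms * of_nat m powr s"
proof -
  have "(\<Prod>j<length cs. of_nat ((ms @ [m]) ! j) powr ((cs @ [s]) ! j)) = powr_prod cs ms"
    unfolding powr_prod_def using assms by (intro prod.cong) (auto simp: nth_append)
  then show ?thesis
    using assms by (simp add: powr_prod_def nth_append)
qed

lemma sum_Ttilde_seqs:
  "(\<Sum>ms\<in>Ttilde_seqs (Suc (length ks)) m. 1 / powr_prod (map of_nat (rev ks) @ [s]) ms) =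
     of_real (nested_sum (0 # ks) m) / of_nat m powr s"
proof (induction ks arbitrary: s m)
  case Nil
  have "(\<Sum>n<m. nested_sum [] n) = 1" if "odd m"
    using that by (simp add: sum.If_cases) (cases m; auto)
  then show ?case
    by (auto simp: Ttilde_seqs_Suc_0 powr_prod_def odd_iff_mod_2_eq_one odd_pos)
next
  case (Cons k ks)
  let ?r = "Suc (length ks)" and ?cs = "map of_nat (rev ks) @ [of_nat k] :: complex list"
  show ?case
  proof (cases "0 < m \<and> m mod 2 = Suc ?r mod 2")
    case True
    have "(\<Sum>ms\<in>Ttilde_seqs (Suc ?r) m. 1 / powr_prod (?cs @ [s]) ms) =
        (\<Sum>ns\<in>(\<Union>n<m. Ttilde_seqs ?r n). 1 / powr_prod (?cs @ [s]) (ns @ [m]))"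
      using True by (simp add: Ttilde_seqs_Suc sum.reindex inj_on_def)
    also have "\<dots> = (\<Sum>n<m. \<Sum>ns\<in>Ttilde_seqs ?r n. 1 / powr_prod (?cs @ [s]) (ns @ [m]))"
      by (rule sum.UNION_disjoint) (simp, simp add: finite_Ttilde_seqs, auto simp: Ttilde_seqs_def)
    also have "\<dots> = (\<Sum>n<m. \<Sum>ns\<in>Ttilde_seqs ?r n. 1 / powr_prod ?cs ns / of_nat m powr s)"
      by (intro sum.cong refl, subst powr_prod_snoc) (auto simp: Ttilde_seqs_def)
    also have "\<dots> = (\<Sum>n<m. of_real (nested_sum (0 # ks) n) / of_nat n powr of_nat k) / of_nat m powr s"
      by (simp only: Cons.IH flip: sum_divide_distrib)
    also have "(\<Sum>n<m. of_real (nested_sum (0 # ks) n) / of_nat n powr of_nat k) =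
        (\<Sum>n<m. complex_of_real (nested_sum (k # ks) n))"
    proof (intro sum.cong refl)
      fix n
      show "of_real (nested_sum (0 # ks) n) / of_nat n powr of_nat k = complex_of_real (nested_sum (k # ks) n)"
        by (cases "n = 0") simp_all
    qed
    also have "\<dots> = of_real (nested_sum (0 # k # ks) m)"
      using True by simp
    finally show ?thesis by simp
  next
    case False
    then show ?thesis by (auto simp: Ttilde_seqs_Suc)
  qed
qed

lemma Ttilde_term_eq:
  "2 ^ Suc (length ks) * Ttilde_term (map of_nat (rev ks) @ [s]) m =
     of_real (tcoeff (0 # ks) m) / of_nat m powr s"
proof -
  have "Ttilde_term (map of_nat (rev ks) @ [s]) m = 
    (-1) ^ ((m - Suc (length ks)) div 2) *
      (\<Sum>ms\<in>Ttilde_seqs (Suc (length ks)) m. 1 / powr_prod (map of_nat (rev ks) @ [s]) ms)"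
    by (simp add: Ttilde_term_def powr_prod_def sum_distrib_left)
  then show ?thesis
    unfolding sum_Ttilde_seqs by (simp add: tcoeff_def del: nested_sum.simps)
qed

lemma Ttilde_term_index:
  "2 ^ Suc (length ks) * Ttilde_term (map of_nat (rev (k # ks))) m = of_real (tcoeff (k # ks) m)"
proof -
  have "complex_of_real (tcoeff (0 # ks) m) / of_nat m powr of_nat k = of_real (tcoeff (k # ks) m)"
    by (cases "m = 0") (simp_all add: tcoeff_0 flip: tcoeff_power[of k])
  then show ?thesis
    using Ttilde_term_eq[of ks "of_nat k"] by simp
qed

lemma Ttilde_index:
  assumes "is_index ks"
  shows "Ttilde (map of_nat (rev ks)) = of_real (tval ks)"
    and "Ttilde_converges (map of_nat (rev ks))"
proof -
  have "Ttilde (map of_nat (rev ks)) = of_real (tval ks) \<and> Ttilde_converges (map of_nat (rev ks))"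
  proof (cases ks)
    case Nil
    then show ?thesis by (simp add: Ttilde_def Ttilde_converges_def)
  next
    case (Cons k ls)
    have "(\<lambda>m. complex_of_real (tcoeff ks m)) sums of_real (tval ks)"
      unfolding tval_def by (intro sums_of_real summable_sums summable_tcoeff assms)
    then have *: "(\<lambda>m. 2 ^ length ks * Ttilde_term (map of_nat (rev ks)) m) sums of_real (tval ks)"
      using Ttilde_term_index[of ls k] Cons by simp
    then have s: "summable (Ttilde_term (map of_nat (rev ks)))"
      using sums_summable summable_cmult_iff[of "2 ^ length ks :: complex"] by fastforce
    then have "2 ^ length ks * (\<Sum>m. Ttilde_term (map of_nat (rev ks)) m) = of_real (tval ks)"
      using sums_unique[OF *] by (simp add: suminf_mult)
    then show ?thesis
      using s Cons by (simp add: Ttilde_def Ttilde_converges_def)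
  qed
  then show "Ttilde (map of_nat (rev ks)) = of_real (tval ks)"
    and "Ttilde_converges (map of_nat (rev ks))" by auto
qed

lemma tval_in_values:
  assumes "is_index ks"
  shows "complex_of_real (tval ks) \<in> multiple_Ttilde_values (wt ks)"
  unfolding multiple_Ttilde_values_def
  using assms Ttilde_index[OF assms] by (intro CollectI exI[of _ "rev ks"]) simp

lemma values_cases:
  assumes "v \<in> multiple_Ttilde_values w"
  obtains ks where "is_index ks" "wt ks = w" "v = of_real (tval ks)"
proof -
  obtain ls where ls: "is_index ls" "wt ls = w" "v = Ttilde (map of_nat ls)"
    using assms by (auto simp: multiple_Ttilde_values_def)
  then show ?thesis
    using that[of "rev ls"] Ttilde_index(1)[of "rev ls"] by simp
qed

lemma Gamma_integral_scaled:
  assumes "0 < Re s" "0 < a"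
  defines "f \<equiv> \<lambda>t. indicator {0<..} t *\<^sub>R (complex_of_real t powr (s - 1) * of_real (exp (- (a * t))))"
  shows "integrable lborel f" and "integral\<^sup>L lborel f = Gamma s / of_real a powr s"
proof -
  define g where "g c t = indicator {0<..} t *\<^sub>R (complex_of_real t powr (s - 1) * of_real (exp (- (c * t))))" for c t
  have meas: "g c \<in> borel_measurable lborel" for c
  proof -
    have "continuous_on {0<..} (\<lambda>t. complex_of_real t powr (s - 1) * of_real (exp (- (c * t))))"
      by (intro continuous_intros) auto
    then show ?thesis
      unfolding g_def by (simp add: borel_measurable_continuous_on_indicator)
  qed
  have int: "integrable lborel (g c)" if "0 < c" for c
  proof -
    have "(\<lambda>t. complex_of_real t powr (s - 1) / of_real (exp (c * t))) absolutely_integrable_on {0<..}"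
      using assms that by (intro absolutely_integrable_Gamma_integral)
    then have "integrable lebesgue (g c)"
      unfolding set_integrable_def g_def[abs_def] by (simp add: exp_minus divide_inverse of_real_inverse)
    then show ?thesis
      using integrable_completion[OF meas] by blast
  qed
  then show "integrable lborel f"
    using assms unfolding f_def g_def[abs_def] by blast
  have "(\<lambda>t. complex_of_real t powr (s - 1) * of_real (exp (- (1 * t)))) = 
      (\<lambda>t. complex_of_real t powr (s - 1) / of_real (exp t))"
    by (simp add: fun_eq_iff exp_minus divide_inverse of_real_inverse)
  then have "integral\<^sup>L lborel (g 1) = Gamma s"
    using set_borel_integral_eq_integral(2)[of "{0<..}" "\<lambda>t. complex_of_real t powr (s - 1) * of_real (exp (- (1 * t)))"]
      int[of 1] Gamma_integral_complex'[OF assms(1)]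
    unfolding set_integrable_def set_lebesgue_integral_def g_def[abs_def]
    by (simp add: integral_unique)
  moreover have "integral\<^sup>L lborel (g 1) = \<bar>a\<bar> *\<^sub>R (\<integral>x. g 1 (0 + a * x) \<partial>lborel)"
    using assms by (intro lborel_integral_real_affine) auto
  moreover have "g 1 (0 + a * x) = of_real a powr (s - 1) * f x" for x
    using assms by (auto simp: g_def f_def indicator_def zero_less_mult_iff powr_times_real)
  ultimately have "Gamma s = of_real a * of_real a powr (s - 1) * integral\<^sup>L lborel f"
    using assms(1,2) by (simp add: scaleR_conv_of_real mult.assoc)
  also have "of_real a * of_real a powr (s - 1) = complex_of_real a powr s"
    using assms by (simp add: powr_diff)
  finally show "integral\<^sup>L lborel f = Gamma s / of_real a powr s"
    using assms by simp
qed

lemma summable_tcoeff_over_powr: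
  assumes "is_index ks" "1 < \<sigma>"
  shows "summable (\<lambda>m. \<bar>tcoeff (0 # ks) m\<bar> / real m powr \<sigma>)"
proof -
  define e where "e = min 1 ((\<sigma> - 1) / 2)"
  have e: "0 < e" "e \<le> 1" "e - \<sigma> < -1" using assms by (auto simp: e_def min_def field_simps)
  obtain C where C: "0 \<le> C" "\<And>m. \<bar>tcoeff (0 # ks) m\<bar> \<le> C * real m powr e"
    using tcoeff_bound[OF assms(1) e(1,2)] by metis
  have s: "summable (\<lambda>m. C * real m powr (e - \<sigma>))"
    using e by (intro summable_mult) (simp add: summable_real_powr_iff)
  show ?thesis
  proof (rule summable_comparison_test'[OF s, of 0])
    fix m :: nat
    have "\<bar>tcoeff (0 # ks) m\<bar> / real m powr \<sigma> \<le> C * real m powr e / real m powr \<sigma>"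
      using C(2) by (rule divide_right_mono) simp
    then show "norm (\<bar>tcoeff (0 # ks) m\<bar> / real m powr \<sigma>) \<le> C * real m powr (e - \<sigma>)"
      by (simp add: powr_diff)
  qed
qed

lemma Mellin_tser:
  assumes "is_index ks" "1 < Re s"
  defines "f \<equiv> \<lambda>t. indicator {0<..} t *\<^sub>R (complex_of_real t powr (s - 1) * of_real (tser (0 # ks) t))"
  shows "integrable lborel f"
    and "integral\<^sup>L lborel f = Gamma s * Ttilde (map of_nat (rev ks) @ [s])"
proof -
  define h where "h s m t = indicator {0<..} t *\<^sub>R (complex_of_real t powr (s - 1) * of_real (exp (- (real m * t))))"
    for s :: complex and m :: nat and t :: real
  define F where "F m t = complex_of_real (tcoeff (0 # ks) m) * h s m t" for m t
  have h: "integrable lborel (h s m)" "integral\<^sup>L lborel (h s m) = Gamma s / of_nat m powr s"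
    if "0 < m" "0 < Re s" for s m
    using Gamma_integral_scaled[of s "real m"] that by (simp_all add: h_def[abs_def])
  have F: "integrable lborel (F m)" 
    "integral\<^sup>L lborel (F m) = Gamma s * (of_real (tcoeff (0 # ks) m) / of_nat m powr s)" for m
    using h[of m s] assms by (cases "m = 0"; simp add: F_def[abs_def] tcoeff_0)+
  have norm_h: "complex_of_real (norm (h s m t)) = h (of_real (Re s)) m t" for m t
  proof -
    have "complex_of_real (Re s) - 1 = of_real (Re s - 1)" by simp
    then show ?thesis
      by (simp add: h_def norm_mult norm_powr_real_powr indicator_def powr_of_real del: of_real_diff)
  qed
  have nF: "(\<integral>t. norm (F m t) \<partial>lborel) = Gamma (Re s) * (\<bar>tcoeff (0 # ks) m\<bar> / real m powr Re s)" for m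
  proof (cases "m = 0")
    case False
    have "complex_of_real (\<integral>t. norm (h s m t) \<partial>lborel) = (\<integral>t. h (of_real (Re s)) m t \<partial>lborel)"
      unfolding norm_h[symmetric] by (rule integral_complex_of_real[symmetric])
    also have "\<dots> = of_real (Gamma (Re s) / real m powr Re s)"
      using h(2)[of m "of_real (Re s)"] False assms
      by (simp add: Gamma_complex_of_real powr_of_real[symmetric])
    finally have "(\<integral>t. norm (h s m t) \<partial>lborel) = Gamma (Re s) / real m powr Re s"
      by (simp only: of_real_eq_iff)
    then show ?thesis by (simp add: F_def norm_mult)
  qed (simp add: F_def tcoeff_0)
  have sums1: "summable (\<lambda>m. \<integral>t. norm (F m t) \<partial>lborel)"
    unfolding nF by (intro summable_mult summable_tcoeff_over_powr assms)
  have F_eq: "F m t = indicator {0<..} t *\<^sub>R (complex_of_real t powr (s - 1)) * of_real (tcoeff (0 # ks) m * exp (-t) ^ m)" for m t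
    by (simp add: F_def h_def exp_of_nat_mult[symmetric] mult_ac)
  have summ: "summable (\<lambda>m. norm (F m t))" for t
  proof (cases "0 < t")
    case True
    have s: "summable (\<lambda>m. tcoeff (0 # ks) m * exp (- (t / 2)) ^ m)"
      using True assms by (intro summable_tcoeff_power) auto
    have "summable (\<lambda>m. norm (tcoeff (0 # ks) m * exp (-t) ^ m))"
      by (rule powser_insidea[OF s]) (use True in simp)
    then have "summable (\<lambda>m. norm (complex_of_real t powr (s - 1)) * norm (tcoeff (0 # ks) m * exp (-t) ^ m))"
      by (rule summable_mult)
    then show ?thesis
      using True unfolding F_eq by (simp only: norm_mult norm_of_real real_norm_def indicator_def) simp
  qed (simp add: F_eq indicator_def)
  have f_eq: "f t = (\<Sum>m. F m t)" for t
  proof (cases "0 < t")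
    case True
    have "(\<lambda>m. tcoeff (0 # ks) m * exp (-t) ^ m) sums tser (0 # ks) t"
      unfolding tser_def using True assms by (intro summable_sums summable_tcoeff_power) auto
    then have "(\<lambda>m. complex_of_real (tcoeff (0 # ks) m * exp (-t) ^ m)) sums of_real (tser (0 # ks) t)"
      by (rule sums_of_real)
    then have "(\<lambda>m. F m t) sums (indicator {0<..} t *\<^sub>R (complex_of_real t powr (s - 1)) * of_real (tser (0 # ks) t))"
      unfolding F_eq by (rule sums_mult)
    then show ?thesis by (simp add: sums_iff f_def)
  qed (simp add: F_eq indicator_def f_def)
  have AE: "AE t in lborel. summable (\<lambda>m. norm (F m t))"
    using summ by simp
  show "integrable lborel f"
    unfolding f_eq[abs_def] by (rule integrable_suminf[OF F(1) AE sums1])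
  have "(\<lambda>m. Gamma s * (of_real (tcoeff (0 # ks) m) / of_nat m powr s)) sums integral\<^sup>L lborel f"
    using sums_integral[OF F(1) AE sums1] unfolding F(2) f_eq[symmetric] .
  moreover have "Gamma s \<noteq> 0"
    using assms by (intro Gamma_nonzero) (auto elim!: nonpos_Ints_cases)
  ultimately have "(\<lambda>m. Gamma s * (of_real (tcoeff (0 # ks) m) / of_nat m powr s) / (Gamma s * 2 ^ Suc (length ks)))
      sums (integral\<^sup>L lborel f / (Gamma s * 2 ^ Suc (length ks)))"
    by (intro sums_divide)
  then have "(\<lambda>m. Ttilde_term (map of_nat (rev ks) @ [s]) m)
      sums (integral\<^sup>L lborel f / (Gamma s * 2 ^ Suc (length ks)))"
    using \<open>Gamma s \<noteq> 0\<close> by (simp del: power_Suc flip: Ttilde_term_eq)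
  then have "integral\<^sup>L lborel f / (Gamma s * 2 ^ Suc (length ks)) = (\<Sum>m. Ttilde_term (map of_nat (rev ks) @ [s]) m)"
    by (rule sums_unique)
  then show "integral\<^sup>L lborel f = Gamma s * Ttilde (map of_nat (rev ks) @ [s])"
    using \<open>Gamma s \<noteq> 0\<close> by (simp add: Ttilde_def field_simps)
qed

section \<open>Shuffle product\<close>

lemma eq_limit_of_has_vector_derivative_zero:
  fixes f :: "real \<Rightarrow> 'a::real_normed_vector"
  assumes deriv: "\<And>t. 0 < t \<Longrightarrow> (f has_vector_derivative 0) (at t)"
    and lim: "(f \<longlongrightarrow> l) F" and F: "\<forall>\<^sub>F t in F. 0 < t" "F \<noteq> bot" and "0 < t"
  shows "f t = l"
proof -
  obtain c where c: "\<And>t. t \<in> {0<..} \<Longrightarrow> f t = c"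
    by (rule has_vector_derivative_zero_constant[of "{0<..}" f])
       (use deriv in \<open>auto intro: has_vector_derivative_at_within\<close>)
  have "(f \<longlongrightarrow> c) F"
    by (rule tendsto_eventually) (use F(1) in \<open>eventually_elim, simp add: c\<close>)
  then have "c = l" using lim F(2) tendsto_unique by blast
  then show ?thesis using c \<open>0 < t\<close> by simp
qed

definition lift_index :: "nat \<Rightarrow> nat list \<Rightarrow> nat list" where
  "lift_index k ks = (if k = 1 then 1 # ks else Suc (hd ks) # tl ks)"

definition lift_weight :: "nat \<Rightarrow> real \<Rightarrow> real" where
  "lift_weight k t = (if k = 1 then 1 / cosh t else 1)"

lemma is_index_lift:
  "is_index ks \<Longrightarrow> k = 1 \<or> ks \<noteq> [] \<Longrightarrow> is_index (lift_index k ks) \<and> wt (lift_index k ks) = Suc (wt ks)"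
  by (cases ks) (auto simp: lift_index_def)

lemma DERIV_tser_lift:
  assumes "is_index ks" "k = 1 \<or> ks \<noteq> []" "0 < t"
  shows "(tser (lift_index k ks) has_real_derivative - (lift_weight k t * tser ks t)) (at t)"
proof (cases "k = 1")
  case True
  then show ?thesis
    using DERIV_tser[OF assms(1,3), of 0] tser_zero[OF assms(1,3)]
    by (simp add: lift_index_def lift_weight_def)
next
  case False
  then obtain l ls where "ks = l # ls" using assms by (cases ks) auto
  then show ?thesis
    using False DERIV_tser[of ls t l] assms by (simp add: lift_index_def lift_weight_def)
qed

lemma lift_index_exists:
  assumes "is_index (k # ks)"
  obtains ls where "is_index ls" "lift_index k ls = k # ks" "k = 1 \<or> ls \<noteq> []"
proof (cases "k = 1")
  case True
  then show ?thesis using that[of ks] assms by (simp add: lift_index_def)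
next
  case False
  then show ?thesis using that[of "(k - 1) # ks"] assms by (simp add: lift_index_def)
qed

lemma DERIV_sum_list_lift:
  assumes "\<forall>ks\<in>set kss. is_index ks \<and> ks \<noteq> []" "0 < t"
  shows "((\<lambda>t. \<Sum>ks\<leftarrow>map (lift_index k) kss. tser ks t) has_real_derivative
     - (lift_weight k t * (\<Sum>ks\<leftarrow>kss. tser ks t))) (at t)"
  using assms(1)
proof (induction kss)
  case (Cons ks kss)
  have "(tser (lift_index k ks) has_real_derivative - (lift_weight k t * tser ks t)) (at t)"
    using Cons.prems assms(2) by (intro DERIV_tser_lift) auto
  moreover have "((\<lambda>t. \<Sum>ks\<leftarrow>map (lift_index k) kss. tser ks t) has_real_derivative
     - (lift_weight k t * (\<Sum>ks\<leftarrow>kss. tser ks t))) (at t)"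
    using Cons by simp
  ultimately show ?case
    using DERIV_add by (fastforce simp: distrib_left)
qed simp

lemma sum_list_tser_tendsto_0:
  assumes "\<forall>ks\<in>set kss. is_index ks \<and> ks \<noteq> []"
  shows "((\<lambda>t. \<Sum>ks\<leftarrow>kss. tser ks t) \<longlongrightarrow> 0) at_top"
  using assms
proof (induction kss)
  case (Cons ks kss)
  then have "(tser ks \<longlongrightarrow> 0) at_top"
    by (cases ks) (auto intro: tser_tendsto_0)
  with Cons show ?case
    using tendsto_add[of "tser ks" 0 at_top "\<lambda>t. \<Sum>ks\<leftarrow>kss. tser ks t" 0] by simp
qed simp

text \<open>Both sides vanish at infinity, and by induction their derivatives agree.\<close>

lemma tser_shuffle:
  assumes "is_index ks" "is_index ls"
  shows "\<exists>kss. (\<forall>ms\<in>set kss. is_index ms \<and> wt ms = wt ks + wt ls) \<and>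
    (\<forall>t>0. tser ks t * tser ls t = (\<Sum>ms\<leftarrow>kss. tser ms t))"
  using assms
proof (induction "wt ks + wt ls" arbitrary: ks ls rule: less_induct)
  case less
  show ?case
  proof (cases "ks = [] \<or> ls = []")
    case True
    then show ?thesis
      using less.prems by (intro exI[of _ "[ks @ ls]"]) auto
  next
    case False
    obtain k ks0 where ks: "is_index ks0" "lift_index k ks0 = ks" "k = 1 \<or> ks0 \<noteq> []"
      using lift_index_exists less.prems False by (metis list.exhaust)
    obtain l ls0 where ls: "is_index ls0" "lift_index l ls0 = ls" "l = 1 \<or> ls0 \<noteq> []"
      using lift_index_exists less.prems False by (metis list.exhaust)
    have wt_ks: "wt ks = Suc (wt ks0)" and wt_ls: "wt ls = Suc (wt ls0)"
      using is_index_lift ks ls by auto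
    obtain kss1 where kss1: "\<forall>ms\<in>set kss1. is_index ms \<and> wt ms = wt ks0 + wt ls"
        "\<forall>t>0. tser ks0 t * tser ls t = (\<Sum>ms\<leftarrow>kss1. tser ms t)"
      using less.hyps[of ks0 ls] wt_ks ks(1) less.prems by auto
    obtain kss2 where kss2: "\<forall>ms\<in>set kss2. is_index ms \<and> wt ms = wt ks + wt ls0"
        "\<forall>t>0. tser ks t * tser ls0 t = (\<Sum>ms\<leftarrow>kss2. tser ms t)"
      using less.hyps[of ks ls0] wt_ls ls(1) less.prems by auto
    have ne1: "\<forall>ms\<in>set kss1. is_index ms \<and> ms \<noteq> []" and ne2: "\<forall>ms\<in>set kss2. is_index ms \<and> ms \<noteq> []"
      using kss1(1) kss2(1) wt_ks wt_ls by fastforce+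
    define kss where "kss = map (lift_index k) kss1 @ map (lift_index l) kss2"
    have kss: "\<forall>ms\<in>set kss. is_index ms \<and> wt ms = wt ks + wt ls"
      using ne1 ne2 kss1(1) kss2(1) wt_ks wt_ls is_index_lift by (fastforce simp: kss_def)
    then have ne: "\<forall>ms\<in>set kss. is_index ms \<and> ms \<noteq> []"
      using wt_ks by fastforce
    have "tser ks t * tser ls t - (\<Sum>ms\<leftarrow>kss. tser ms t) = 0" if "0 < t" for t
    proof (rule eq_limit_of_has_vector_derivative_zero[OF _ _ eventually_gt_at_top _ that])
      fix t :: real assume t: "0 < t"
      have "((\<lambda>t. tser ks t * tser ls t) has_real_derivative
          - (lift_weight k t * (\<Sum>ms\<leftarrow>kss1. tser ms t)) - lift_weight l t * (\<Sum>ms\<leftarrow>kss2. tser ms t)) (at t)"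
        using DERIV_mult[OF DERIV_tser_lift[OF ks(1,3) t] DERIV_tser_lift[OF ls(1,3) t]] t
          kss1(2)[rule_format, OF t, symmetric] kss2(2)[rule_format, OF t, symmetric]
        by (simp add: ks(2) ls(2) algebra_simps)
      moreover have "((\<lambda>t. \<Sum>ms\<leftarrow>kss. tser ms t) has_real_derivative
          - (lift_weight k t * (\<Sum>ms\<leftarrow>kss1. tser ms t)) + - (lift_weight l t * (\<Sum>ms\<leftarrow>kss2. tser ms t))) (at t)"
        using DERIV_add[OF DERIV_sum_list_lift[OF ne1 t] DERIV_sum_list_lift[OF ne2 t]]
        by (simp add: kss_def)
      ultimately show "((\<lambda>t. tser ks t * tser ls t - (\<Sum>ms\<leftarrow>kss. tser ms t)) has_vector_derivative 0) (at t)"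
        unfolding has_real_derivative_iff_has_vector_derivative[symmetric]
        by (auto intro: DERIV_cong[OF DERIV_diff])
    next
      obtain k' ks' where "ks = k' # ks'" using False by (cases ks) auto
      moreover obtain l' ls' where "ls = l' # ls'" using False by (cases ls) auto
      ultimately have "(tser ks \<longlongrightarrow> 0) at_top" "(tser ls \<longlongrightarrow> 0) at_top"
        using less.prems tser_tendsto_0 by auto
      from tendsto_diff[OF tendsto_mult[OF this] sum_list_tser_tendsto_0[OF ne]]
      show "((\<lambda>t. tser ks t * tser ls t - (\<Sum>ms\<leftarrow>kss. tser ms t)) \<longlongrightarrow> 0) at_top"
        by simp
    qed simp
    then show ?thesis using kss by (intro exI[of _ kss]) simp
  qed
qed

lemma sum_list_tser_tendsto_tval:
  assumes "\<forall>ks\<in>set kss. is_index ks"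
  shows "((\<lambda>t. \<Sum>ks\<leftarrow>kss. tser ks t) \<longlongrightarrow> (\<Sum>ks\<leftarrow>kss. tval ks)) (at_right 0)"
  using assms by (induction kss) (auto intro!: tendsto_intros tser_tendsto_tval)

lemma tval_mult:
  assumes "is_index ks" "is_index ls"
  obtains kss where "\<And>ms. ms \<in> set kss \<Longrightarrow> is_index ms \<and> wt ms = wt ks + wt ls"
    and "tval ks * tval ls = (\<Sum>ms\<leftarrow>kss. tval ms)"
proof -
  obtain kss where kss: "\<forall>ms\<in>set kss. is_index ms \<and> wt ms = wt ks + wt ls"
      "\<forall>t>0. tser ks t * tser ls t = (\<Sum>ms\<leftarrow>kss. tser ms t)"
    using tser_shuffle assms by blast
  have "((\<lambda>t. \<Sum>ms\<leftarrow>kss. tser ms t) \<longlongrightarrow> tval ks * tval ls) (at_right 0)"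
    by (rule Lim_transform_eventually[OF tendsto_mult[OF tser_tendsto_tval[OF assms(1)] tser_tendsto_tval[OF assms(2)]]])
       (use kss(2) in \<open>auto simp: eventually_at_right_less intro!: eventually_at_rightI[of 0 1]\<close>)
  moreover have "((\<lambda>t. \<Sum>ms\<leftarrow>kss. tser ms t) \<longlongrightarrow> (\<Sum>ms\<leftarrow>kss. tval ms)) (at_right 0)"
    using kss(1) by (intro sum_list_tser_tendsto_tval) auto
  ultimately have "tval ks * tval ls = (\<Sum>ms\<leftarrow>kss. tval ms)"
    by (intro tendsto_unique[of "at_right 0"]) simp_all
  then show ?thesis using kss(1) that by blast
qed

lemma tval_in_span: "is_index ks \<Longrightarrow> of_real (tval ks) \<in> rat_complex.span (multiple_Ttilde_values (wt ks))"
  by (intro rat_complex.span_base tval_in_values)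

lemma span_mult_tval:
  assumes "c \<in> rat_complex.span (multiple_Ttilde_values u)" "is_index ls" "w = u + wt ls"
  shows "c * of_real (tval ls) \<in> rat_complex.span (multiple_Ttilde_values w)"
  using assms(1)
proof (induction rule: rat_complex.span_induct_alt)
  case base
  then show ?case by (simp add: rat_complex.span_zero)
next
  case (step q x y)
  obtain ks where ks: "is_index ks" "wt ks = u" "x = of_real (tval ks)"
    using values_cases[OF step(1)] by metis
  obtain kss where kss: "\<And>ms. ms \<in> set kss \<Longrightarrow> is_index ms \<and> wt ms = wt ks + wt ls"
      "tval ks * tval ls = (\<Sum>ms\<leftarrow>kss. tval ms)"
    using tval_mult[OF ks(1) assms(2)] by metis
  have "complex_of_real (\<Sum>ms\<leftarrow>kss. tval ms) \<in> rat_complex.span (multiple_Ttilde_values w)"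
    using kss(1)
  proof (induction kss)
    case Nil
    then show ?case by (simp add: rat_complex.span_zero)
  next
    case (Cons ms kss)
    then have "of_real (tval ms) \<in> rat_complex.span (multiple_Ttilde_values w)"
      using tval_in_span[of ms] assms(3) ks(2) by simp
    then show ?case
      using Cons by (simp add: rat_complex.span_add)
  qed
  then have "x * of_real (tval ls) \<in> rat_complex.span (multiple_Ttilde_values w)"
    using ks(3) kss(2) by (metis of_real_mult)
  then show ?case
    using rat_complex.span_add[OF rat_complex.span_scale[of _ _ q] step(2)]
    by (simp add: distrib_right mult.assoc)
qed

section \<open>Primitives and Mellin transforms of combinations\<close>

inductive tcomb :: "nat \<Rightarrow> (real \<Rightarrow> complex) \<Rightarrow> bool" for w where
  zero: "tcomb w (\<lambda>_. 0)"
| add: "tcomb w f \<Longrightarrow> is_index ks \<Longrightarrow> wt ks + j \<le> w \<Longrightarrow>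
    c \<in> rat_complex.span (multiple_Ttilde_values (w - wt ks - j)) \<Longrightarrow>
    tcomb w (\<lambda>t. c * of_real (tser ks t * (t ^ j / fact j)) + f t)"

lemma tcomb_add: "tcomb w f \<Longrightarrow> tcomb w g \<Longrightarrow> tcomb w (\<lambda>t. f t + g t)"
proof (induction rule: tcomb.induct)
  case (add f ks j c)
  then show ?case
    using tcomb.add[OF add.IH[OF add.prems] add.hyps(2-4)] by (simp add: add.assoc)
qed simp

lemma tcomb_uminus: "tcomb w f \<Longrightarrow> tcomb w (\<lambda>t. - f t)"
proof (induction rule: tcomb.induct)
  case (add f ks j c)
  have "- c \<in> rat_complex.span (multiple_Ttilde_values (w - wt ks - j))"
    using add.hyps(4) by (rule rat_complex.span_neg)
  from tcomb.add[OF add.IH add.hyps(2,3) this] show ?case by simp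
qed (simp add: tcomb.zero)

lemma tcomb_single:
  assumes "is_index ks" "wt ks + j \<le> w"
    "c \<in> rat_complex.span (multiple_Ttilde_values (w - wt ks - j))"
  shows "tcomb w (\<lambda>t. c * of_real (tser ks t * (t ^ j / fact j)))"
  using tcomb.add[OF tcomb.zero assms] by simp

lemma has_vector_derivative_of_real_cmult:
  "(f has_real_derivative f') (at t) \<Longrightarrow>
    ((\<lambda>t. c * complex_of_real (f t)) has_vector_derivative c * of_real f') (at t)"
  by (intro has_vector_derivative_mult_right has_vector_derivative_of_real)

lemma DERIV_power_fact:
  "((\<lambda>t. t ^ Suc j / fact (Suc j)) has_real_derivative t ^ j / fact j) (at t)"
  using DERIV_cdivide[OF DERIV_pow[of "Suc j"], of "fact (Suc j)"]
  by (simp del: of_nat_Suc power_Suc)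

lemma primitive_tser:
  assumes "is_index ks" "wt ks + x + j \<le> w"
    and "c \<in> rat_complex.span (multiple_Ttilde_values (w - wt ks - x - j))"
  shows "\<exists>g. tcomb (Suc w) g \<and> (g \<longlongrightarrow> 0) (at_right 0) \<and>
    (\<forall>t>0. (g has_vector_derivative c * of_real (tser (x # ks) t * (t ^ j / fact j))) (at t))"
  using assms(2,3)
proof (induction j arbitrary: x)
  case 0
  let ?ks = "Suc x # ks"
  have idx: "is_index ?ks" using assms(1) by simp
  define g where "g t = c * of_real (tval ?ks) * of_real (tser [] t * (t ^ 0 / fact 0)) +
    (- c) * of_real (tser ?ks t * (t ^ 0 / fact 0))" for t
  have "tcomb (Suc w) g"
    unfolding g_def
  proof (intro tcomb_add tcomb_single)
    show "- c \<in> rat_complex.span (multiple_Ttilde_values (Suc w - wt ?ks - 0))"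
      using 0 rat_complex.span_neg by (simp add: add.commute)
    show "c * of_real (tval ?ks) \<in> rat_complex.span (multiple_Ttilde_values (Suc w - wt [] - 0))"
      using 0 by (intro span_mult_tval[OF 0(2) idx]) simp
  qed (use 0 idx in auto)
  moreover have "(g has_vector_derivative c * of_real (tser (x # ks) t * (t ^ 0 / fact 0))) (at t)"
    if "0 < t" for t
    using has_vector_derivative_diff[OF has_vector_derivative_const
        has_vector_derivative_of_real_cmult[OF DERIV_tser[OF assms(1) that, of x]], of "c * of_real (tval ?ks)" c]
    by (simp add: g_def[abs_def])
  moreover have "(g \<longlongrightarrow> 0) (at_right 0)"
  proof -
    have "((\<lambda>t. c * of_real (tval ?ks) - c * of_real (tser ?ks t)) \<longlongrightarrow>
        c * of_real (tval ?ks) - c * of_real (tval ?ks)) (at_right 0)"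
      by (intro tendsto_intros tser_tendsto_tval idx)
    then show ?thesis by (simp add: g_def[abs_def])
  qed
  ultimately show ?case by (intro exI[of _ g]) simp
next
  case (Suc j)
  let ?ks = "Suc x # ks"
  have idx: "is_index ?ks" using assms(1) by simp
  obtain g where g: "tcomb (Suc w) g" "(g \<longlongrightarrow> 0) (at_right 0)"
    "\<And>t. t > 0 \<Longrightarrow> (g has_vector_derivative c * of_real (tser ?ks t * (t ^ j / fact j))) (at t)"
    using Suc.IH[of "Suc x"] Suc.prems by auto
  define h where "h t = (- c) * of_real (tser ?ks t * (t ^ Suc j / fact (Suc j))) + g t" for t
  have "tcomb (Suc w) h"
    unfolding h_def
  proof (intro tcomb_add tcomb_single g(1))
    show "- c \<in> rat_complex.span (multiple_Ttilde_values (Suc w - wt ?ks - Suc j))"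
      using Suc.prems rat_complex.span_neg by (simp add: add.commute)
  qed (use Suc.prems idx in auto)
  moreover have "(h has_vector_derivative c * of_real (tser (x # ks) t * (t ^ Suc j / fact (Suc j)))) (at t)"
    if t: "0 < t" for t
  proof -
    have "((\<lambda>t. tser ?ks t * (t ^ Suc j / fact (Suc j))) has_real_derivative
        - tser (x # ks) t * (t ^ Suc j / fact (Suc j)) + t ^ j / fact j * tser ?ks t) (at t)"
      by (intro DERIV_mult DERIV_tser DERIV_power_fact assms t)
    from has_vector_derivative_add[OF has_vector_derivative_of_real_cmult[OF this, of "- c"] g(3)[OF t]]
    have "(h has_vector_derivative - c * of_real (- tser (x # ks) t * (t ^ Suc j / fact (Suc j)) + t ^ j / fact j * tser ?ks t)
        + c * of_real (tser ?ks t * (t ^ j / fact j))) (at t)"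
      unfolding h_def .
    moreover have "- c * of_real (- A * B + C * D) + c * of_real (D * C) = c * of_real (A * B)" for A B C D
      by (simp add: algebra_simps)
    ultimately show ?thesis by metis
  qed
  moreover have "(h \<longlongrightarrow> (- c) * of_real (tval ?ks * (0 ^ Suc j / fact (Suc j))) + 0) (at_right 0)"
    unfolding h_def using tser_tendsto_tval[OF idx] g(2) by (intro tendsto_intros) auto
  ultimately show ?case by (intro exI[of _ h]) simp
qed

definition is_primitive :: "(real \<Rightarrow> complex) \<Rightarrow> (real \<Rightarrow> complex) \<Rightarrow> bool" where
  "is_primitive g f \<longleftrightarrow> (g \<longlongrightarrow> 0) (at_right 0) \<and> (\<forall>t>0. (g has_vector_derivative f t) (at t))"

lemma is_primitive_add:
  "is_primitive g1 f1 \<Longrightarrow> is_primitive g2 f2 \<Longrightarrow> is_primitive (\<lambda>t. g1 t + g2 t) (\<lambda>t. f1 t + f2 t)"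
  unfolding is_primitive_def
  by (auto intro!: has_vector_derivative_add tendsto_add_zero)

lemma primitive_tser_plain:
  assumes "is_index ks" "wt ks + j \<le> w"
    and "c \<in> rat_complex.span (multiple_Ttilde_values (w - wt ks - j))"
  shows "\<exists>g. tcomb (Suc w) g \<and> is_primitive g (\<lambda>t. c * of_real (tser ks t * (t ^ j / fact j)))"
proof (cases ks)
  case Nil
  define g where "g t = c * of_real (tser [] t * (t ^ Suc j / fact (Suc j)))" for t
  have "tcomb (Suc w) g"
    unfolding g_def using assms Nil by (intro tcomb_single) auto
  moreover have "(g has_vector_derivative c * of_real (t ^ j / fact j)) (at t)" for t
    using has_vector_derivative_of_real_cmult[OF DERIV_power_fact] by (simp add: g_def[abs_def])
  moreover have "(g \<longlongrightarrow> c * of_real (1 * (0 ^ Suc j / fact (Suc j)))) (at_right 0)"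
    unfolding g_def tser_Nil by (intro tendsto_intros) auto
  ultimately show ?thesis
    using Nil by (intro exI[of _ g]) (simp add: is_primitive_def)
next
  case (Cons x ls)
  then have "\<exists>g. tcomb (Suc w) g \<and> (g \<longlongrightarrow> 0) (at_right 0) \<and>
    (\<forall>t>0. (g has_vector_derivative c * of_real (tser (x # ls) t * (t ^ j / fact j))) (at t))"
    using assms by (intro primitive_tser) (auto simp: add_ac)
  then show ?thesis
    unfolding is_primitive_def Cons by blast
qed

lemma tcomb_primitive:
  assumes "tcomb w f"
  shows "\<exists>g. tcomb (Suc w) g \<and> is_primitive g f"
  using assms
proof (induction rule: tcomb.induct)
  case zero
  then show ?case
    by (intro exI[of _ "\<lambda>_. 0"]) (simp add: is_primitive_def tcomb.zero)
next
  case (add f ks j c)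
  then show ?case
    using primitive_tser_plain[OF add.hyps(2-4)] is_primitive_add tcomb_add by blast
qed

lemma tcomb_primitive_cosh:
  assumes "tcomb w f"
  shows "\<exists>g. tcomb (Suc w) g \<and> is_primitive g (\<lambda>t. f t / of_real (cosh t))"
  using assms
proof (induction rule: tcomb.induct)
  case zero
  then show ?case
    by (intro exI[of _ "\<lambda>_. 0"]) (simp add: is_primitive_def tcomb.zero)
next
  case (add f ks j c)
  obtain g1 where g1: "tcomb (Suc w) g1" "(g1 \<longlongrightarrow> 0) (at_right 0)"
    "\<And>t. t > 0 \<Longrightarrow> (g1 has_vector_derivative c * of_real (tser (0 # ks) t * (t ^ j / fact j))) (at t)"
    using primitive_tser[of ks 0 j w c] add.hyps by auto
  have "is_primitive g1 (\<lambda>t. c * of_real (tser ks t * (t ^ j / fact j)) / of_real (cosh t))"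
    unfolding is_primitive_def
    using g1 add.hyps(2) by (auto simp: tser_zero mult_ac)
  moreover obtain g2 where g2: "tcomb (Suc w) g2" "is_primitive g2 (\<lambda>t. f t / of_real (cosh t))"
    using add.IH by blast
  ultimately show ?case
    using tcomb_add[OF g1(1) g2(1)] is_primitive_add unfolding add_divide_distrib by blast
qed

lemma tcomb_Mellin:
  assumes "tcomb w f"
  shows "\<exists>C. (\<forall>(ks, j)\<in>bounded_pairs w. C ks j \<in> rat_complex.span (multiple_Ttilde_values (w - wt ks - j))) \<and>
    (\<forall>s. 1 < Re s \<longrightarrow>
       set_integrable lborel {0<..} (\<lambda>t. complex_of_real t powr (s - 1) * f t / of_real (cosh t)) \<and>
       (LINT t:{0<..}|lborel. complex_of_real t powr (s - 1) * f t / of_real (cosh t)) =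
         Gamma s * (\<Sum>(ks, j)\<in>bounded_pairs w. C ks j * ((s + of_nat j - 1) gchoose j) *
            Ttilde (map of_nat ks @ [s + of_nat j])))"
  using assms
proof (induction rule: tcomb.induct)
  case zero
  then show ?case
    by (intro exI[of _ "\<lambda>_ _. 0"]) (auto simp: rat_complex.span_zero set_integrable_def)
next
  case (add f ls i c)
  define H where "H s C = (\<Sum>(ks, j)\<in>bounded_pairs w. C ks j * ((s + of_nat j - 1) gchoose j) *
            Ttilde (map of_nat ks @ [s + of_nat j]))" for s :: complex and C :: "nat list \<Rightarrow> nat \<Rightarrow> complex"
  obtain C where C: "\<And>ks j. (ks, j) \<in> bounded_pairs w \<Longrightarrow> C ks j \<in> rat_complex.span (multiple_Ttilde_values (w - wt ks - j))"
      "\<And>s. 1 < Re s \<Longrightarrow> set_integrable lborel {0<..} (\<lambda>t. complex_of_real t powr (s - 1) * f t / of_real (cosh t))"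
      "\<And>s. 1 < Re s \<Longrightarrow> (LINT t:{0<..}|lborel. complex_of_real t powr (s - 1) * f t / of_real (cosh t)) = Gamma s * H s C"
    using add.IH unfolding H_def by auto
  define E where "E ks j = (if ks = rev ls \<and> j = i then c else 0)" for ks j
  have mem: "(rev ls, i) \<in> bounded_pairs w"
    using add.hyps by (simp add: bounded_pairs_def)
  have spn: "C ks j + E ks j \<in> rat_complex.span (multiple_Ttilde_values (w - wt ks - j))"
    if "(ks, j) \<in> bounded_pairs w" for ks j
    using C(1)[OF that] add.hyps(4) by (auto simp: E_def intro!: rat_complex.span_add)
  have H_add: "H s (\<lambda>ks j. C ks j + E ks j) = H s C + H s E" for s
    unfolding H_def by (simp add: sum.distrib[symmetric] algebra_simps case_prod_unfold)
  have H_E: "H s E = c * ((s + of_nat i - 1) gchoose i) * Ttilde (map of_nat (rev ls) @ [s + of_nat i])" for s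
  proof -
    have "H s E = (\<Sum>p\<in>{(rev ls, i)}. case p of (ks, j) \<Rightarrow> E ks j * ((s + of_nat j - 1) gchoose j) *
            Ttilde (map of_nat ks @ [s + of_nat j]))"
      unfolding H_def
      by (rule sum.mono_neutral_right) (use mem finite_bounded_pairs in \<open>auto simp: E_def split: if_splits\<close>)
    then show ?thesis by (simp add: E_def)
  qed
  have "set_integrable lborel {0<..} (\<lambda>t. complex_of_real t powr (s - 1) * (c * of_real (tser ls t * (t ^ i / fact i)) + f t) / of_real (cosh t)) \<and>
       (LINT t:{0<..}|lborel. complex_of_real t powr (s - 1) * (c * of_real (tser ls t * (t ^ i / fact i)) + f t) / of_real (cosh t)) =
         Gamma s * H s (\<lambda>ks j. C ks j + E ks j)" if s: "1 < Re s" for s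
  proof -
    define g where "g t = complex_of_real t powr (s + of_nat i - 1) * of_real (tser (0 # ls) t)" for t
    have si: "1 < Re (s + of_nat i)" using s by simp
    have g: "set_integrable lborel {0<..} g"
      "(LINT t:{0<..}|lborel. g t) = Gamma (s + of_nat i) * Ttilde (map of_nat (rev ls) @ [s + of_nat i])"
      using Mellin_tser[OF add.hyps(2) si]
      by (simp_all add: g_def[abs_def] set_integrable_def set_lebesgue_integral_def)
    have eq: "complex_of_real t powr (s - 1) * (c * of_real (tser ls t * (t ^ i / fact i)) + f t) / of_real (cosh t) =
      c / fact i * g t + complex_of_real t powr (s - 1) * f t / of_real (cosh t)" if "t \<in> {0<..}" for t
    proof -
      have "s + of_nat i - 1 = (s - 1) + of_nat i" by simp
      then have "complex_of_real t powr (s + of_nat i - 1) = of_real t powr (s - 1) * of_real t powr of_nat i"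
        by (simp only: powr_add)
      also have "of_real t powr of_nat i = complex_of_real (t ^ i)" using that by simp
      finally show ?thesis
        using that add.hyps(2) by (simp add: g_def tser_zero field_simps)
    qed
    have "s \<notin> \<int>\<^sub>\<le>\<^sub>0" using s by (auto elim!: nonpos_Ints_cases)
    then have binom: "c / fact i * Gamma (s + of_nat i) = Gamma s * (c * ((s + of_nat i - 1) gchoose i))"
      using s by (simp add: gbinomial_pochhammer' pochhammer_Gamma Gamma_eq_zero_iff)
    have int: "set_integrable lborel {0<..} (\<lambda>t. c / fact i * g t)"
      using g(1) by (rule set_integrable_mult_right)
    have "set_integrable lborel {0<..} (\<lambda>t. c / fact i * g t + complex_of_real t powr (s - 1) * f t / of_real (cosh t))"
      using int C(2)[OF s] by (rule set_integral_add)
    moreover have "(LINT t:{0<..}|lborel. c / fact i * g t + complex_of_real t powr (s - 1) * f t / of_real (cosh t)) =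
       c / fact i * (Gamma (s + of_nat i) * Ttilde (map of_nat (rev ls) @ [s + of_nat i])) + Gamma s * H s C"
      using set_integral_add(2)[OF int C(2)[OF s]] g(2) C(3)[OF s] by simp
    moreover have "c / fact i * (Gamma (s + of_nat i) * Ttilde (map of_nat (rev ls) @ [s + of_nat i])) + Gamma s * H s C =
      Gamma s * H s (\<lambda>ks j. C ks j + E ks j)"
      unfolding H_add H_E mult.assoc[symmetric] binom by (simp add: algebra_simps)
    moreover have "set_integrable lborel {0<..} (\<lambda>t. complex_of_real t powr (s - 1) * (c * of_real (tser ls t * (t ^ i / fact i)) + f t) / of_real (cosh t)) \<longleftrightarrow>
      set_integrable lborel {0<..} (\<lambda>t. c / fact i * g t + complex_of_real t powr (s - 1) * f t / of_real (cosh t))"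
      by (rule set_integrable_cong) (auto simp only: eq)
    moreover have "(LINT t:{0<..}|lborel. complex_of_real t powr (s - 1) * (c * of_real (tser ls t * (t ^ i / fact i)) + f t) / of_real (cosh t)) =
      (LINT t:{0<..}|lborel. c / fact i * g t + complex_of_real t powr (s - 1) * f t / of_real (cosh t))"
      by (rule set_lebesgue_integral_cong) (simp, use eq in blast)
    ultimately show ?thesis by presburger
  qed
  then show ?case
    using spn unfolding H_def by (intro exI[of _ "\<lambda>ks j. C ks j + E ks j"]) auto
qed

section \<open>The polylogarithm along the arc\<close>

declare polylog4.simps(2) [simp del]

lemma polylog4_has_field_derivative:
  assumes "0 < Im z"
  shows "(polylog4 (ks @ [k]) has_field_derivative
    (if k \<ge> 2 then 1 / z * polylog4 (ks @ [k - 1]) z else 2 / (1 - z\<^sup>2) * polylog4 ks z)) (at z)"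
  using assms
proof (induction "sum_list ks + k + length ks" arbitrary: ks k z rule: less_induct)
  case less
  let ?H = "{z. 0 < Im z}"
  have H: "open ?H" "convex ?H" "\<i> \<in> ?H"
    by (simp_all add: open_halfspace_Im_gt convex_halfspace_Im_gt)
  define f where "f u = (if k \<ge> 2 then 1 / u * polylog4 (ks @ [k - 1]) u else 2 / (1 - u\<^sup>2) * polylog4 ks u)" for u
  have sq: "1 - u\<^sup>2 \<noteq> 0" and nz: "u \<noteq> 0" if "u \<in> ?H" for u
  proof -
    show "u \<noteq> 0" using that by auto
    have "u \<noteq> 1" "u \<noteq> - 1" using that by auto
    then show "1 - u\<^sup>2 \<noteq> 0" by (simp add: power2_eq_1_iff)
  qed
  have "f holomorphic_on ?H"
  proof (cases "k \<ge> 2")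
    case True
    then have "polylog4 (ks @ [k - 1]) holomorphic_on ?H"
      using less.hyps[of ks "k - 1"] H(1)
      by (auto simp: holomorphic_on_open)
    then show ?thesis
      using True nz unfolding f_def by (auto intro!: holomorphic_intros)
  next
    case False
    have "polylog4 ks holomorphic_on ?H"
    proof (cases ks rule: rev_cases)
      case Nil
      then have "polylog4 ks = (\<lambda>_. 1)" by (simp add: fun_eq_iff)
      then show ?thesis by simp
    next
      case (snoc ls l)
      then show ?thesis
        using less.hyps[of ls l] H(1) by (auto simp: holomorphic_on_open)
    qed
    then show ?thesis
      using False sq unfolding f_def by (auto intro!: holomorphic_intros)
  qed
  then obtain g where g: "\<And>u. u \<in> ?H \<Longrightarrow> (g has_field_derivative f u) (at u within ?H)"
    using holomorphic_convex_primitive'[OF H(2,1)] by metis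
  have eq: "polylog4 (ks @ [k]) u = g u - g \<i>" if "u \<in> ?H" for u
  proof -
    have "(f has_contour_integral (g (pathfinish (linepath \<i> u)) - g (pathstart (linepath \<i> u)))) (linepath \<i> u)"
      using H that by (intro contour_integral_primitive[OF g]) (auto simp: closed_segment_subset)
    then have "contour_integral (linepath \<i> u) f = g u - g \<i>"
      by (simp add: contour_integral_unique)
    then show ?thesis
      unfolding f_def by (subst polylog4.simps(2), cases "k \<ge> 2") simp_all
  qed
  have "(g has_field_derivative f z) (at z)"
    using g[of z] at_within_open[OF _ H(1), of z] less.prems by simp
  from DERIV_diff[OF this DERIV_const[of "g \<i>"]]
  have "((\<lambda>u. g u - g \<i>) has_field_derivative f z) (at z)" by simp
  then have "(polylog4 (ks @ [k]) has_field_derivative f z) (at z)"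
    by (rule has_field_derivative_transform_within_open[OF _ H(1)]) (use less.prems eq in auto)
  then show ?case by (simp add: f_def)
qed

lemma polylog4_snoc_i: "polylog4 (ks @ [k]) \<i> = 0"
  by (subst polylog4.simps(2)) simp

text \<open>This is \<open>tanh (t/2 + \<pi>\<i>/4)\<close>; it pulls \<open>2 du / (1 - u\<^sup>2)\<close> back to \<open>dt\<close> and \<open>du / u\<close> to
  \<open>- \<i> dt / cosh t\<close>.\<close>

definition tanh_arc :: "real \<Rightarrow> complex" where
  "tanh_arc t = (\<i> * of_real (exp t) - 1) / (\<i> * of_real (exp t) + 1)"

lemma tanh_arc_denominator: "\<i> * complex_of_real (exp t) + 1 \<noteq> 0"
proof
  assume "\<i> * complex_of_real (exp t) + 1 = 0"
  then have "Im (\<i> * complex_of_real (exp t) + 1) = 0" by simp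
  then show False by simp
qed

lemma tanh_eq_arc: "tanh (complex_of_real t / 2 + complex_of_real pi * \<i> / 4) = tanh_arc t"
proof -
  define x where "x = complex_of_real t / 2 + complex_of_real pi * \<i> / 4"
  define u where "u = exp x"
  have "x + x = of_real t + of_real pi / 2 * \<i>"
    by (simp add: x_def)
  then have "u * u = exp (of_real t + of_real pi / 2 * \<i>)"
    unfolding u_def exp_add[symmetric] by (rule arg_cong)
  also have "\<dots> = \<i> * of_real (exp t)"
    using cis_conv_exp[of "pi / 2"] by (simp add: exp_add exp_of_real mult_ac)
  finally have uu: "u * u = \<i> * of_real (exp t)" .
  have "u \<noteq> 0" by (simp add: u_def)
  have "tanh x = (u - 1 / u) / (u + 1 / u)"
    by (simp add: tanh_altdef u_def exp_minus inverse_eq_divide)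
  also have "\<dots> = (u * (u - 1 / u)) / (u * (u + 1 / u))"
    using \<open>u \<noteq> 0\<close> by simp
  also have "\<dots> = (u * u - 1) / (u * u + 1)"
    using \<open>u \<noteq> 0\<close> by (simp add: distrib_left right_diff_distrib)
  finally show ?thesis by (simp add: uu tanh_arc_def x_def)
qed

lemma tanh_arc_has_vector_derivative:
  "(tanh_arc has_vector_derivative 2 * \<i> * of_real (exp t) / (\<i> * of_real (exp t) + 1)\<^sup>2) (at t)"
proof -
  have e: "((\<lambda>t. \<i> * complex_of_real (exp t)) has_vector_derivative \<i> * of_real (exp t)) (at t)"
    by (intro has_vector_derivative_of_real_cmult DERIV_exp)
  have "((\<lambda>w. (w - 1) / (w + 1)) has_field_derivative 2 / (w + 1)\<^sup>2) (at w)" if "w + 1 \<noteq> 0" for w :: complex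
    using that by (auto intro!: derivative_eq_intros simp: field_simps power2_eq_square)
  from field_vector_diff_chain_at[OF e this[OF tanh_arc_denominator]]
  show ?thesis by (simp add: o_def tanh_arc_def[abs_def] mult_ac)
qed

lemma tanh_arc_eq: "tanh_arc t = Complex (tanh t) (1 / cosh t)"
proof -
  define E where "E = exp t"
  have E: "0 < E" by (simp add: E_def)
  then have pos: "1 + E\<^sup>2 \<noteq> 0" by (metis add_pos_pos less_irrefl zero_less_one zero_less_power)
  have c: "cosh t = (1 + E\<^sup>2) / (2 * E)" and s: "sinh t = (E\<^sup>2 - 1) / (2 * E)"
    using E by (simp_all add: cosh_def sinh_def E_def exp_minus field_simps power2_eq_square)
  have "Complex (tanh t) (1 / cosh t) = Complex ((E\<^sup>2 - 1) / (1 + E\<^sup>2)) (2 * E / (1 + E\<^sup>2))"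
    using E pos by (simp add: tanh_def c s)
  moreover have "Complex ((E\<^sup>2 - 1) / (1 + E\<^sup>2)) (2 * E / (1 + E\<^sup>2)) * (\<i> * of_real E + 1) = \<i> * of_real E - 1"
    using pos by (simp add: complex_eq_iff divide_simps) (simp add: algebra_simps power2_eq_square)
  ultimately have "Complex (tanh t) (1 / cosh t) * (\<i> * of_real E + 1) = \<i> * of_real E - 1"
    by simp
  then show ?thesis
    using tanh_arc_denominator[of t] by (simp add: tanh_arc_def E_def divide_eq_eq)
qed

lemma Im_tanh_arc_pos: "0 < Im (tanh_arc t)"
  by (simp add: tanh_arc_eq)

lemma tanh_arc_0: "tanh_arc 0 = \<i>"
  by (simp add: tanh_arc_eq complex_eq_iff)

lemma tanh_arc_form_one:
  "2 * \<i> * of_real (exp t) / (\<i> * of_real (exp t) + 1)\<^sup>2 * (2 / (1 - (tanh_arc t)\<^sup>2)) = 1"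
proof -
  define w where "w = \<i> * complex_of_real (exp t)"
  have w: "w + 1 \<noteq> 0" "w \<noteq> 0" using tanh_arc_denominator by (auto simp: w_def)
  have "1 - (tanh_arc t)\<^sup>2 = 4 * w / (w + 1)\<^sup>2"
    using w by (simp add: tanh_arc_def w_def[symmetric] power_divide divide_simps) (simp add: power2_eq_square algebra_simps)
  then have "2 * w / (w + 1)\<^sup>2 * (2 / (1 - (tanh_arc t)\<^sup>2)) = 1"
    using w by simp
  then show ?thesis by (simp add: w_def mult.assoc)
qed

lemma tanh_arc_form_zero:
  "2 * \<i> * of_real (exp t) / (\<i> * of_real (exp t) + 1)\<^sup>2 * (1 / tanh_arc t) = - \<i> / of_real (cosh t)"
proof -
  define E where "E = complex_of_real (exp t)"
  have p: "\<i> * E + 1 \<noteq> 0" using tanh_arc_denominator by (simp add: E_def)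
  have m: "\<i> * E - 1 \<noteq> 0" 
  proof
    assume "\<i> * E - 1 = 0"
    then have "Im (\<i> * E - 1) = 0" by simp
    then show False by (simp add: E_def)
  qed
  have E: "E \<noteq> 0" by (simp add: E_def)
  have prod: "(\<i> * E + 1) * (\<i> * E - 1) = - (1 + E\<^sup>2)"
    by (simp add: algebra_simps power2_eq_square)
  have "complex_of_real (cosh t) = (1 + E\<^sup>2) / (2 * E)"
    using E by (simp add: cosh_def E_def exp_minus of_real_inverse field_simps power2_eq_square scaleR_conv_of_real)
  moreover have "- \<i> / (W / (2 * E)) = 2 * \<i> * E / - W" for W
    by simp
  ultimately have rhs: "- \<i> / of_real (cosh t) = 2 * \<i> * E / - (1 + E\<^sup>2)"
    by (simp only:)
  have "2 * \<i> * E / (\<i> * E + 1)\<^sup>2 * (1 / tanh_arc t) = 2 * \<i> * E / ((\<i> * E + 1) * (\<i> * E - 1))"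
    using p m by (simp add: tanh_arc_def E_def[symmetric] power2_eq_square)
  then show ?thesis unfolding E_def[symmetric] prod rhs .
qed

lemma polylog4_arc_derivative:
  "((\<lambda>t. polylog4 (ks @ [k]) (tanh_arc t)) has_vector_derivative
     (if k \<ge> 2 then - \<i> / of_real (cosh t) * polylog4 (ks @ [k - 1]) (tanh_arc t) else polylog4 ks (tanh_arc t))) (at t)"
proof -
  let ?v = "2 * \<i> * of_real (exp t) / (\<i> * of_real (exp t) + 1)\<^sup>2"
  have "(polylog4 (ks @ [k]) \<circ> tanh_arc has_vector_derivative ?v * 
    (if k \<ge> 2 then 1 / tanh_arc t * polylog4 (ks @ [k - 1]) (tanh_arc t)
     else 2 / (1 - (tanh_arc t)\<^sup>2) * polylog4 ks (tanh_arc t))) (at t)"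
    by (intro field_vector_diff_chain_at tanh_arc_has_vector_derivative polylog4_has_field_derivative Im_tanh_arc_pos)
  moreover have "?v * (1 / tanh_arc t * X) = - \<i> / of_real (cosh t) * X" for X
    by (simp only: mult.assoc[symmetric] tanh_arc_form_zero)
  moreover have "?v * (2 / (1 - (tanh_arc t)\<^sup>2) * X) = X" for X
    by (simp only: mult.assoc[symmetric] tanh_arc_form_one mult_1_left)
  ultimately show ?thesis
    by (cases "k \<ge> 2") (simp_all only: o_def if_True if_False)
qed

lemma eq_of_has_vector_derivative_eq:
  fixes f g :: "real \<Rightarrow> complex"
  assumes "\<And>t. 0 < t \<Longrightarrow> (f has_vector_derivative h t) (at t)"
    and "\<And>t. 0 < t \<Longrightarrow> (g has_vector_derivative h t) (at t)"
    and "(f \<longlongrightarrow> l) (at_right 0)" "(g \<longlongrightarrow> l) (at_right 0)" and "0 < t"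
  shows "f t = g t"
proof -
  have "f t - g t = 0"
  proof (rule eq_limit_of_has_vector_derivative_zero[OF _ _ eventually_at_right_less _ \<open>0 < t\<close>])
    show "((\<lambda>t. f t - g t) has_vector_derivative 0) (at t)" if "0 < t" for t
      using has_vector_derivative_diff[OF assms(1)[OF that] assms(2)[OF that]] by simp
    show "((\<lambda>t. f t - g t) \<longlongrightarrow> 0) (at_right 0)"
      using tendsto_diff[OF assms(3,4)] by simp
  qed simp
  then show ?thesis by simp
qed

lemma polylog4_arc_tcomb:
  assumes "is_index ks"
  shows "\<exists>g. tcomb (wt ks) g \<and> (\<forall>t>0. polylog4 ks (tanh_arc t) = \<i> ^ (wt ks - dep ks) * g t)"
  using assms
proof (induction "wt ks" arbitrary: ks rule: less_induct)
  case less
  show ?case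
  proof (cases ks rule: rev_cases)
    case Nil
    have "(1::complex) \<in> rat_complex.span (multiple_Ttilde_values 0)"
      using tval_in_span[of "[]"] by simp
    then have "tcomb 0 (\<lambda>t. 1 * of_real (tser [] t * (t ^ 0 / fact 0)))"
      by (intro tcomb_single) auto
    then show ?thesis using Nil by (intro exI[of _ "\<lambda>_. 1"]) (simp add: dep_def)
  next
    case (snoc ls k)
    have ls: "is_index ls" "1 \<le> k" and wt: "wt ks = wt ls + k"
      using less.prems snoc by (auto simp: is_index_def wt_def)
    have dep_le: "dep ls \<le> wt ls"
      using ls(1) unfolding dep_def by (induction ls) auto
    have lim: "((\<lambda>t. polylog4 ks (tanh_arc t)) \<longlongrightarrow> 0) (at_right 0)"
    proof -
      have "isCont (\<lambda>t. polylog4 ks (tanh_arc t)) 0"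
        unfolding snoc using polylog4_arc_derivative by (rule has_vector_derivative_continuous)
      then have "((\<lambda>t. polylog4 ks (tanh_arc t)) \<longlongrightarrow> polylog4 ks (tanh_arc 0)) (at_right 0)"
        unfolding isCont_def by (rule tendsto_mono[rotated]) (simp add: at_le)
      then show ?thesis using polylog4_snoc_i snoc by (simp add: tanh_arc_0)
    qed
    show ?thesis
    proof (cases "k = 1")
      case True
      obtain f where f: "tcomb (wt ls) f" "\<And>t. 0 < t \<Longrightarrow> polylog4 ls (tanh_arc t) = \<i> ^ (wt ls - dep ls) * f t"
        using less.hyps[of ls] ls wt by auto
      obtain g where g: "tcomb (Suc (wt ls)) g" "is_primitive g f"
        using tcomb_primitive[OF f(1)] by blast
      have e: "wt ks - dep ks = wt ls - dep ls" using True wt snoc by (simp add: dep_def)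
      have "polylog4 ks (tanh_arc t) = \<i> ^ (wt ks - dep ks) * g t" if "0 < t" for t
      proof (rule eq_of_has_vector_derivative_eq[OF _ _ lim _ that])
        fix t :: real assume t: "0 < t"
        show "((\<lambda>t. polylog4 ks (tanh_arc t)) has_vector_derivative \<i> ^ (wt ls - dep ls) * f t) (at t)"
          using polylog4_arc_derivative[of ls k t] True snoc f(2)[OF t] by simp
        show "((\<lambda>t. \<i> ^ (wt ks - dep ks) * g t) has_vector_derivative \<i> ^ (wt ls - dep ls) * f t) (at t)"
          unfolding e using g(2) t by (auto simp: is_primitive_def intro!: has_vector_derivative_mult_right)
      next
        show "((\<lambda>t. \<i> ^ (wt ks - dep ks) * g t) \<longlongrightarrow> 0) (at_right 0)"
          using g(2) by (auto simp: is_primitive_def intro!: tendsto_mult_right_zero)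
      qed
      then show ?thesis using g(1) True wt by (intro exI[of _ g]) simp
    next
      case False
      then have k: "2 \<le> k" using ls by simp
      let ?ms = "ls @ [k - 1]"
      have ms: "is_index ?ms" "wt ks = Suc (wt ?ms)" "dep ks = dep ?ms" "dep ?ms \<le> wt ?ms"
        using ls k snoc wt dep_le by (auto simp: is_index_def wt_def dep_def)
      obtain f where f: "tcomb (wt ?ms) f" "\<And>t. 0 < t \<Longrightarrow> polylog4 ?ms (tanh_arc t) = \<i> ^ (wt ?ms - dep ?ms) * f t"
        using less.hyps[of ?ms] ms by auto
      obtain g where g: "tcomb (Suc (wt ?ms)) g" "is_primitive g (\<lambda>t. - f t / of_real (cosh t))"
        using tcomb_primitive_cosh[OF tcomb_uminus[OF f(1)]] by blast
      have e: "wt ks - dep ks = Suc (wt ?ms - dep ?ms)" using ms(2-4) by (simp only: Suc_diff_le)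
      define h where "h t = \<i> ^ (wt ks - dep ks) * (- f t / of_real (cosh t))" for t
      have "polylog4 ks (tanh_arc t) = \<i> ^ (wt ks - dep ks) * g t" if "0 < t" for t
      proof (rule eq_of_has_vector_derivative_eq[OF _ _ lim _ that])
        fix t :: real assume t: "0 < t"
        have "h t = - \<i> / of_real (cosh t) * polylog4 ?ms (tanh_arc t)"
          unfolding h_def f(2)[OF t] e by simp
        then show "((\<lambda>t. polylog4 ks (tanh_arc t)) has_vector_derivative h t) (at t)"
          using polylog4_arc_derivative[of ls k t] k snoc by simp
        show "((\<lambda>t. \<i> ^ (wt ks - dep ks) * g t) has_vector_derivative h t) (at t)"
          unfolding h_def using g(2) t by (auto simp only: is_primitive_def intro!: has_vector_derivative_mult_right)
      next
        show "((\<lambda>t. \<i> ^ (wt ks - dep ks) * g t) \<longlongrightarrow> 0) (at_right 0)"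
          using g(2) by (auto simp: is_primitive_def intro!: tendsto_mult_right_zero)
      qed
      then show ?thesis using g(1) ms by (intro exI[of _ g]) simp
    qed
  qed
qed

theorem theorem2p2:
  fixes ks :: "nat list"
  assumes "1 \<le> dep ks" and "is_index ks"
  shows "\<exists>C :: nat list \<Rightarrow> nat \<Rightarrow> complex.
    (\<forall>(ks', j)\<in>bounded_pairs (wt ks).
       C ks' j \<in> rat_complex.span (multiple_Ttilde_values (wt ks - wt ks' - j))) \<and>
    (\<forall>s::complex. Re s > 1 \<longrightarrow>
       KT_lambda ks s = \<i> ^ (wt ks - dep ks) *
         (\<Sum>(ks', j)\<in>bounded_pairs (wt ks).
            C ks' j * ((s + of_nat j - 1) gchoose j) *
            Ttilde (map of_nat ks' @ [s + of_nat j])))"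
proof -
  obtain g where g: "tcomb (wt ks) g" "\<And>t. 0 < t \<Longrightarrow> polylog4 ks (tanh_arc t) = \<i> ^ (wt ks - dep ks) * g t"
    using polylog4_arc_tcomb[OF assms(2)] by blast
  define H where "H s C = (\<Sum>(ks', j)\<in>bounded_pairs (wt ks). C ks' j * ((s + of_nat j - 1) gchoose j) *
            Ttilde (map of_nat ks' @ [s + of_nat j]))" for s :: complex and C :: "nat list \<Rightarrow> nat \<Rightarrow> complex"
  obtain C where C: "\<forall>(ks', j)\<in>bounded_pairs (wt ks). C ks' j \<in> rat_complex.span (multiple_Ttilde_values (wt ks - wt ks' - j))"
    "\<And>s. 1 < Re s \<Longrightarrow> (LINT t:{0<..}|lborel. complex_of_real t powr (s - 1) * g t / of_real (cosh t)) = Gamma s * H s C"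
    using tcomb_Mellin[OF g(1)] unfolding H_def by auto
  have "KT_lambda ks s = \<i> ^ (wt ks - dep ks) * H s C" if s: "1 < Re s" for s
  proof -
    have "Gamma s \<noteq> 0"
      using s by (intro Gamma_nonzero) (auto elim!: nonpos_Ints_cases)
    have "KT_lambda ks s = 1 / Gamma s *
        (LINT t:{0<..}|lborel. \<i> ^ (wt ks - dep ks) * (complex_of_real t powr (s - 1) * g t / of_real (cosh t)))"
      unfolding KT_lambda_def tanh_eq_arc
      by (intro arg_cong2[where f = "(*)"] refl set_lebesgue_integral_cong) (auto simp: g(2))
    also have "\<dots> = \<i> ^ (wt ks - dep ks) * H s C"
      unfolding set_integral_mult_right C(2)[OF s] using \<open>Gamma s \<noteq> 0\<close> by simp
    finally show ?thesis .
  qed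
  then show ?thesis
    using C(1) unfolding H_def by blast
qed

end
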